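(* The group $\mathrm{lp}V=\mathrm{lp}G_{2,1}$ is generated by the set $\{N,C,T\}\cup\{\tau_{i,i+1}:1\le i\}$. More generally, $\mathrm{lp}G_{k,1}$ is generated by $\Gamma_k\cup\{\tau_{i,i+1}:1\le i\}$ for some finite set $\Gamma_k$. The finite alternating group $\mathfrak{A}_{2^n}$ (acting on $\{0,1\}^n$) is generated by the set $\{N,C,T\}\cup\{\tau_{i,i+1}:1\le i<n\}$.
   Context: Fix a finite alphabet $A$ with $|A|=k\ge 2$ ($A=\{0,1\}$ when $k=2$); $A^*$ is the set of finite words over $A$, and $|w|$ is the length of a word $w$. A right ideal of $A^*$ is a set $R$ with $RA^*\subseteq R$; it is essential if it meets every non-empty right ideal. An isomorphism $\varphi:R_1\to R_2$ between right ideals is a bijection with $\varphi(rz)=\varphi(r)z$ for all $r\in R_1$, $z\in A^*$. Every isomorphism between finitely generated essential right ideals has a unique maximal extension to an isomorphism between essential right ideals. $G_{k,1}$ (the Thompson-Higman group) is the group of all maximally extended isomorphisms between finitely generated essential right ideals of $A^*$, with multiplication: composition followed by maximal extension. Any isomorphism between finitely generated essential right ideals represents the element of $G_{k,1}$ given by its maximal extension. $\mathrm{lp}G_{k,1}=\{\varphi\in G_{k,1}:|\varphi(x)|=|x|\ \forall x\in\mathrm{Dom}(\varphi)\}$ is the subgroup of length-preserving elements; $V=G_{2,1}$. For $x_i\in\{0,1\}$ and $w\in\{0,1\}^*$: $N:x_1w\mapsto\overline{x}_1w$; $C:x_1x_2w\mapsto x_1(x_2\oplus x_1)w$; $T:x_1x_2x_3w\mapsto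 x_1x_2(x_3\oplus(x_2\&x_1))w$, where $\overline{x}$ is negation, $\oplus$ is addition mod 2 and $\&$ is multiplication mod 2 (these maps are undefined on words that are too short). For $1\le i<j$, $\tau_{i,j}:A^*\to A^*$ is the partial map $u\,x_i\,v\,x_j\,w\mapsto u\,x_j\,v\,x_i\,w$, where $x_i,x_j\in A$, $u,v,w\in A^*$, $|u|=i-1$, $|v|=j-1-i$ (undefined on words of length $<j$). In the statement about $\mathfrak{A}_{2^n}$, the group of even permutations of the set $\{0,1\}^n$, the maps are considered through their action on $\{0,1\}^n$.
   Formalization: The claim about the alternating group on {0,1}^n is stated for n ≥ 4: for n = 3 the map T is a transposition, hence odd, so the claim fails; for n ≤ 2 some of N, C, T are undefined on {0,1}^n, and where n is 1 or 2 a generator that is defined is odd. *)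

theory Defs
  imports
    "HOL-Combinatorics.Permutations"
    "HOL-Library.Z2"
    "HOL-Algebra.Generated_Groups"
begin

section \<open>Right ideals of the free monoid and their isomorphisms\<close>

text \<open>
  The alphabet is a finite type \<open>'a\<close>, so that the free monoid \<open>A\<^sup>*\<close> is the type
  \<open>'a list\<close>. Partial maps on words are of type \<open>'a list \<rightharpoonup> 'a list\<close>.
\<close>

definition right_ideal :: "'a::finite list set \<Rightarrow> bool" where
  "right_ideal R \<longleftrightarrow> (\<forall>r\<in>R. \<forall>z. r @ z \<in> R)"

definition essential_ri :: "'a::finite list set \<Rightarrow> bool" where
  "essential_ri R \<longleftrightarrow> right_ideal R \<and> (\<forall>I. right_ideal I \<and> I \<noteq> {} \<longrightarrow> R \<inter> I \<noteq> {})"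

definition fin_gen_ri :: "'a::finite list set \<Rightarrow> bool" where
  "fin_gen_ri R \<longleftrightarrow> (\<exists>C. finite C \<and> R = {c @ z | c z. c \<in> C})"

definition ri_iso :: "('a::finite list \<rightharpoonup> 'a list) \<Rightarrow> 'a list set \<Rightarrow> 'a list set \<Rightarrow> bool" where
  "ri_iso \<phi> R1 R2 \<longleftrightarrow> right_ideal R1 \<and> right_ideal R2 \<and> dom \<phi> = R1
     \<and> bij_betw (\<lambda>r. the (\<phi> r)) R1 R2
     \<and> (\<forall>r\<in>R1. \<forall>z. the (\<phi> (r @ z)) = the (\<phi> r) @ z)"

definition ess_iso :: "('a::finite list \<rightharpoonup> 'a list) \<Rightarrow> bool" where
  "ess_iso \<phi> \<longleftrightarrow> (\<exists>R1 R2. essential_ri R1 \<and> essential_ri R2 \<and> ri_iso \<phi> R1 R2)"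

definition fin_gen_ess_iso :: "('a::finite list \<rightharpoonup> 'a list) \<Rightarrow> bool" where
  "fin_gen_ess_iso \<phi> \<longleftrightarrow> (\<exists>R1 R2. fin_gen_ri R1 \<and> fin_gen_ri R2 \<and>
     essential_ri R1 \<and> essential_ri R2 \<and> ri_iso \<phi> R1 R2)"

definition is_max_ext :: "('a::finite list \<rightharpoonup> 'a list) \<Rightarrow> ('a list \<rightharpoonup> 'a list) \<Rightarrow> bool" where
  "is_max_ext \<phi> \<psi> \<longleftrightarrow> ess_iso \<psi> \<and> \<phi> \<subseteq>\<^sub>m \<psi> \<and> (\<forall>\<chi>. ess_iso \<chi> \<and> \<psi> \<subseteq>\<^sub>m \<chi> \<longrightarrow> \<chi> = \<psi>)"

definition max_ext :: "('a::finite list \<rightharpoonup> 'a list) \<Rightarrow> ('a list \<rightharpoonup> 'a list)" where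
  "max_ext \<phi> = (THE \<psi>. is_max_ext \<phi> \<psi>)"


section \<open>The Thompson-Higman group and its length-preserving subgroup\<close>

text \<open>The parameter \<open>k\<close> of \<open>G\<^bsub>k,1\<^esub>\<close> is the number of elements of the type \<open>'a\<close>.\<close>

definition thompson_higman :: "('a::finite list \<rightharpoonup> 'a list) monoid" where
  "thompson_higman =
     \<lparr> carrier = {max_ext \<phi> | \<phi>. fin_gen_ess_iso \<phi>},
       mult = (\<lambda>\<phi> \<psi>. max_ext (\<phi> \<circ>\<^sub>m \<psi>)),
       one = Some \<rparr>"

definition lp_thompson_higman :: "('a::finite list \<rightharpoonup> 'a list) set" where
  "lp_thompson_higman =
     {\<phi> \<in> carrier thompson_higman. \<forall>x\<in>dom \<phi>. length (the (\<phi> x)) = length x}"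


section \<open>Gates and position transpositions\<close>

text \<open>In the field \<open>bit\<close>, addition is exclusive or and multiplication is conjunction.\<close>

instance bit :: finite
proof
  have "(UNIV :: bit set) = {0, 1}"
    using bit_not_zero_iff by blast
  moreover have "finite {0, 1 :: bit}"
    by simp
  ultimately show "finite (UNIV :: bit set)"
    by (rule ssubst)
qed

fun not_gate :: "bit list \<rightharpoonup> bit list" where
  "not_gate (x1 # w) = Some ((x1 + 1) # w)"
| "not_gate _ = None"

fun cnot_gate :: "bit list \<rightharpoonup> bit list" where
  "cnot_gate (x1 # x2 # w) = Some (x1 # (x2 + x1) # w)"
| "cnot_gate _ = None"

fun toffoli_gate :: "bit list \<rightharpoonup> bit list" where
  "toffoli_gate (x1 # x2 # x3 # w) = Some (x1 # x2 # (x3 + x2 * x1) # w)"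
| "toffoli_gate _ = None"

text \<open>Positions in \<open>transp i j\<close> are counted from 1, while list indices start at 0.\<close>

definition transp :: "nat \<Rightarrow> nat \<Rightarrow> ('a::finite list \<rightharpoonup> 'a list)" where
  "transp i j w =
     (if 1 \<le> i \<and> i < j \<and> j \<le> length w
      then Some (w[i - 1 := w ! (j - 1), j - 1 := w ! (i - 1)]) else None)"


section \<open>The alternating group on words of length n\<close>

definition words :: "nat \<Rightarrow> 'a::finite list set" where
  "words n = {w. length w = n}"

definition alt_group_words :: "nat \<Rightarrow> (bit list \<Rightarrow> bit list) monoid" where
  "alt_group_words n =
     \<lparr> carrier = {p. p permutes words n \<and> evenperm p}, mult = (\<circ>), one = id \<rparr>"

text \<open>
  Following the convention of \<open>permutes\<close>, a permutation of \<open>words n\<close> is the identity on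
  words of any other length.
\<close>

definition action :: "nat \<Rightarrow> ('a::finite list \<rightharpoonup> 'a list) \<Rightarrow> 'a list \<Rightarrow> 'a list" where
  "action n f w = (if w \<in> words n then the (f w) else w)"


section \<open>Existence and uniqueness of maximal extensions\<close>

lemma ess_isoD:
  assumes "ess_iso \<phi>"
  shows "essential_ri (dom \<phi>)" "essential_ri (ran \<phi>)"
    and "\<And>x y z. \<phi> x = Some y \<Longrightarrow> \<phi> (x @ z) = Some (y @ z)"
    and "\<And>x x' y. \<phi> x = Some y \<Longrightarrow> \<phi> x' = Some y \<Longrightarrow> x = x'"
proof -
  obtain R1 R2 where e: "essential_ri R1" "essential_ri R2" and i: "ri_iso \<phi> R1 R2"
    using assms unfolding ess_iso_def by blast
  have d: "dom \<phi> = R1" and ri: "right_ideal R1"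
    and b: "bij_betw (\<lambda>r. the (\<phi> r)) R1 R2"
    and h: "\<And>r z. r \<in> R1 \<Longrightarrow> the (\<phi> (r @ z)) = the (\<phi> r) @ z"
    using i unfolding ri_iso_def by auto
  show "essential_ri (dom \<phi>)" using d e by simp
  have "ran \<phi> = (\<lambda>r. the (\<phi> r)) ` dom \<phi>"
    by (force simp: ran_def image_def dom_def)
  then have "ran \<phi> = R2" using b d by (simp add: bij_betw_def)
  then show "essential_ri (ran \<phi>)" using e by simp
  show "\<phi> (x @ z) = Some (y @ z)" if "\<phi> x = Some y" for x y z
  proof -
    have x: "x \<in> R1" using that d by auto
    then have "x @ z \<in> dom \<phi>" using ri d unfolding right_ideal_def by blast
    then show ?thesis using h[OF x, of z] that by auto
  qed
  show "x = x'" if "\<phi> x = Some y" "\<phi> x' = Some y" for x x' y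
    using b that d unfolding bij_betw_def inj_on_def by (metis domI option.sel)
qed

lemma ess_isoI:
  assumes "essential_ri (dom \<phi>)" "essential_ri (ran \<phi>)"
    and h: "\<And>x y z. \<phi> x = Some y \<Longrightarrow> \<phi> (x @ z) = Some (y @ z)"
    and i: "\<And>x x' y. \<phi> x = Some y \<Longrightarrow> \<phi> x' = Some y \<Longrightarrow> x = x'"
  shows "ess_iso \<phi>"
proof -
  have "ran \<phi> = (\<lambda>r. the (\<phi> r)) ` dom \<phi>"
    by (force simp: ran_def image_def dom_def)
  moreover have "inj_on (\<lambda>r. the (\<phi> r)) (dom \<phi>)"
    using i by (auto simp: inj_on_def)
  moreover have "the (\<phi> (x @ z)) = the (\<phi> x) @ z" if "x \<in> dom \<phi>" for x z
    using that h by force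
  ultimately have "ri_iso \<phi> (dom \<phi>) (ran \<phi>)"
    using assms(1,2) unfolding ri_iso_def essential_ri_def bij_betw_def by simp
  then show ?thesis using assms(1,2) unfolding ess_iso_def by blast
qed

lemma essential_ri_extend:
  assumes "essential_ri R"
  obtains z where "x @ z \<in> R"
proof -
  let ?I = "{x @ z | z. True}"
  have "right_ideal ?I" unfolding right_ideal_def by auto
  then have "R \<inter> ?I \<noteq> {}" using assms unfolding essential_ri_def by blast
  then show ?thesis using that by blast
qed

lemma essential_ri_mono:
  assumes "essential_ri R" "R \<subseteq> S" "right_ideal S"
  shows "essential_ri S"
  using assms unfolding essential_ri_def by blast

lemma ess_iso_ext_agree:
  assumes p: "ess_iso \<phi>" and c: "ess_iso \<chi>" "\<phi> \<subseteq>\<^sub>m \<chi>" and c': "ess_iso \<chi>'" "\<phi> \<subseteq>\<^sub>m \<chi>'"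
    and x: "\<chi> x = Some y" and x': "\<chi>' x' = Some y'"
  shows "x = x' \<longleftrightarrow> y = y'"
proof -
  obtain z where z: "x @ z \<in> dom \<phi>"
    using essential_ri_extend[OF ess_isoD(1)[OF p]] .
  obtain u where u: "(x' @ z) @ u \<in> dom \<phi>"
    using essential_ri_extend[OF ess_isoD(1)[OF p]] .
  have zu: "x @ z @ u \<in> dom \<phi>"
    using z ess_isoD(1)[OF p] unfolding essential_ri_def right_ideal_def by (metis append_assoc)
  have "\<phi> (x @ z @ u) = \<chi> (x @ z @ u)" "\<phi> (x' @ z @ u) = \<chi>' (x' @ z @ u)"
    using zu u c(2) c'(2) unfolding map_le_def by auto
  then have "\<phi> (x @ z @ u) = Some (y @ z @ u)" "\<phi> (x' @ z @ u) = Some (y' @ z @ u)"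
    using ess_isoD(3)[OF c(1) x] ess_isoD(3)[OF c'(1) x'] by auto
  then show ?thesis
    using ess_isoD(4)[OF p] by (metis append_same_eq option.inject)
qed

lemma is_max_ext_ex1:
  assumes p: "ess_iso \<phi>"
  shows "\<exists>!\<psi>. is_max_ext \<phi> \<psi>"
proof -
  define E where "E x y \<longleftrightarrow> (\<exists>\<chi>. ess_iso \<chi> \<and> \<phi> \<subseteq>\<^sub>m \<chi> \<and> \<chi> x = Some y)" for x y
  define M where "M x = (if \<exists>y. E x y then Some (THE y. E x y) else None)" for x
  have E_iff: "x = x' \<longleftrightarrow> y = y'" if "E x y" "E x' y'" for x y x' y'
    using that ess_iso_ext_agree[OF p] unfolding E_def by blast
  have M_iff: "M x = Some y \<longleftrightarrow> E x y" for x y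
  proof
    assume "M x = Some y"
    then have "\<exists>y. E x y" "y = (THE y. E x y)"
      unfolding M_def by (auto split: if_splits)
    then show "E x y" using E_iff by (metis the_equality)
  next
    assume e: "E x y"
    then have "(THE y. E x y) = y" using E_iff by blast
    then show "M x = Some y" unfolding M_def using e by auto
  qed
  have ext: "\<chi> \<subseteq>\<^sub>m M" if "ess_iso \<chi>" "\<phi> \<subseteq>\<^sub>m \<chi>" for \<chi>
    unfolding map_le_def
  proof
    fix a assume "a \<in> dom \<chi>"
    then obtain b where b: "\<chi> a = Some b" by blast
    then have "E a b" using that unfolding E_def by blast
    then show "\<chi> a = M a" using b M_iff by metis
  qed
  have h: "M (x @ z) = Some (y @ z)" if "M x = Some y" for x y z
    using that unfolding M_iff E_def using ess_isoD(3) by blast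
  have pM: "\<phi> \<subseteq>\<^sub>m M" using ext[OF p] by simp
  have M: "ess_iso M"
  proof (rule ess_isoI)
    have "right_ideal (dom M)" using h unfolding right_ideal_def by blast
    then show "essential_ri (dom M)"
      using essential_ri_mono[OF ess_isoD(1)[OF p]] map_le_implies_dom_le[OF pM] by blast
    have "right_ideal (ran M)" using h unfolding right_ideal_def ran_def by blast
    moreover have "ran \<phi> \<subseteq> ran M" using pM unfolding ran_def map_le_def by force
    ultimately show "essential_ri (ran M)"
      using essential_ri_mono[OF ess_isoD(2)[OF p]] by blast
    show "x = x'" if "M x = Some y" "M x' = Some y" for x x' y
      using that E_iff M_iff by blast
  qed (use h in blast)
  show ?thesis
  proof (rule ex1I)
    show "is_max_ext \<phi> M"
      unfolding is_max_ext_def using M pM ext by (meson map_le_antisym map_le_trans)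
    show "\<psi> = M" if "is_max_ext \<phi> \<psi>" for \<psi>
      using that M ext unfolding is_max_ext_def by blast
  qed
qed

end

(* A length-preserving element of the Thompson-Higman group permutes the words of length n, for some n,
   and it is determined by this permutation; passing from n to n + 1 lets the permutation act on the
   first n letters only. For n >= 4 the even permutations of the words of length n + 1 are
   generated by those acting on the first n letters and those acting on the last n letters: a
   3-cycle of the one kind and a 3-cycle of the other kind whose supports meet in a single word have
   a 3-cycle as commutator, and the generated group is transitive on triples of distinct words.
   Rotating a word by adjacent transpositions turns "first n" into "last n", so everything reduces
   to n = 4. There, for bits, the commutator of two conjugates of the Toffoli gate is a 3-cycle, and
   affine maps are transitive on triples. Odd permutations become even at the next level if the
   number k of letters is even, and stay odd if k is odd, in which case an odd permutation is put
   into the finite generating set. *)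

theory Submission
  imports Defs
begin

section \<open>Permutation groups containing the even permutations\<close>

abbreviation inv' :: "('a \<Rightarrow> 'a) \<Rightarrow> 'a \<Rightarrow> 'a" where
  "inv' \<equiv> inv_into UNIV"

text \<open>Bare closure conditions on a set of functions, so that the same argument applies to the
  permutations of words that represent elements of a subgroup of the Thompson-Higman group and to a
  subgroup of \<open>alt_group_words n\<close>.\<close>

definition perm_group :: "'a set \<Rightarrow> ('a \<Rightarrow> 'a) set \<Rightarrow> bool" where
  "perm_group S K \<longleftrightarrow> (\<forall>p\<in>K. p permutes S) \<and> id \<in> K \<and> (\<forall>p\<in>K. \<forall>q\<in>K. p \<circ> q \<in> K) \<and> (\<forall>p\<in>K. inv' p \<in> K)"

lemma perm_groupD:
  assumes "perm_group S K"
  shows "p \<in> K \<Longrightarrow> p permutes S" "id \<in> K" "p \<in> K \<Longrightarrow> q \<in> K \<Longrightarrow> p \<circ> q \<in> K"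
    "p \<in> K \<Longrightarrow> inv' p \<in> K"
  using assms unfolding perm_group_def by blast+

text \<open>Finiteness supplies the inverses: composition with p on the left is an injective map
  from K to itself, hence surjective, and so hits the identity.\<close>

lemma perm_groupI:
  assumes S: "finite S" and K: "\<And>p. p \<in> K \<Longrightarrow> p permutes S" "id \<in> K"
    "\<And>p q. p \<in> K \<Longrightarrow> q \<in> K \<Longrightarrow> p \<circ> q \<in> K"
  shows "perm_group S K"
proof -
  have "inv' p \<in> K" if p: "p \<in> K" for p
  proof -
    have "finite K" using K(1) finite_permutations[OF S] by (metis finite_subset mem_Collect_eq subsetI)
    moreover have "inj_on ((\<circ>) p) K"
      using permutes_inj[OF K(1)[OF p]] by (auto intro!: inj_onI simp: fun_eq_iff inj_eq)
    ultimately have "(\<circ>) p ` K = K"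
      using K(3)[OF p] by (intro endo_inj_surj) auto
    then obtain q where q: "q \<in> K" "p \<circ> q = id" using K(2) by (metis imageE)
    have "inv' p = q"
      using q(2) permutes_inv_o(2)[OF K(1)[OF p]] by (metis comp_assoc comp_id id_comp)
    then show ?thesis using q(1) by simp
  qed
  then show ?thesis unfolding perm_group_def using K by blast
qed

section \<open>Three-cycles and the even permutations they generate\<close>

text \<open>For distinct arguments this is the cycle from x to y to z to x. Written as a product of
  two transpositions, it shows its parity at once.\<close>

definition cyc3 :: "'a \<Rightarrow> 'a \<Rightarrow> 'a \<Rightarrow> 'a \<Rightarrow> 'a" where
  "cyc3 x y z = Transposition.transpose x y \<circ> Transposition.transpose y z"

lemma cyc3_apply:
  assumes "x \<noteq> y" "y \<noteq> z" "x \<noteq> z"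
  shows "cyc3 x y z w = (if w = x then y else if w = y then z else if w = z then x else w)"
  using assms by (auto simp: cyc3_def Transposition.transpose_def)

lemma cyc3_permutes: "x \<in> S \<Longrightarrow> y \<in> S \<Longrightarrow> z \<in> S \<Longrightarrow> cyc3 x y z permutes S"
  unfolding cyc3_def by (intro permutes_compose permutes_swap_id)

lemma evenperm_cyc3:
  assumes "x \<noteq> y" "y \<noteq> z"
  shows "evenperm (cyc3 x y z)"
  using assms by (simp add: cyc3_def evenperm_comp permutation_swap_id evenperm_swap)

lemma cyc3_conj:
  assumes "bij h"
  shows "h \<circ> cyc3 x y z \<circ> inv' h = cyc3 (h x) (h y) (h z)"
proof
  fix w
  have t: "Transposition.transpose (h a) (h b) (h c) = h (Transposition.transpose a b c)" for a b c
    using bij_is_inj[OF assms] by (auto simp: Transposition.transpose_def inj_eq)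
  obtain v where "w = h v" using assms by (metis bij_pointE)
  then show "(h \<circ> cyc3 x y z \<circ> inv' h) w = cyc3 (h x) (h y) (h z) w"
    using assms by (simp add: cyc3_def bij_is_inj t)
qed

text \<open>An even permutation is a product of an even number of transpositions, and any two
  transpositions multiply to a product of 3-cycles or to the identity.\<close>

lemma evenperm_in_perm_group:
  assumes K: "perm_group S K" and S: "finite S"
    and c: "\<And>x y z. \<lbrakk>x \<in> S; y \<in> S; z \<in> S; x \<noteq> y; y \<noteq> z; x \<noteq> z\<rbrakk> \<Longrightarrow> cyc3 x y z \<in> K"
    and p: "p permutes S" "evenperm p"
  shows "p \<in> K"
proof -
  note K' = perm_groupD[OF K]
  let ?t = Transposition.transpose
  have share: "?t a b \<circ> ?t b d \<in> K" if "a \<in> S" "b \<in> S" "d \<in> S" "a \<noteq> b" "b \<noteq> d" for a b d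
  proof (cases "a = d")
    case True
    have "?t a b \<circ> ?t b a = id" by (auto simp: fun_eq_iff transpose_commute[of b])
    then show ?thesis using K'(2) True by metis
  qed (use c[of a b d] that in \<open>simp add: cyc3_def\<close>)
  have two: "?t a b \<circ> ?t e d \<in> K"
    if "a \<in> S" "b \<in> S" "e \<in> S" "d \<in> S" "a \<noteq> b" "e \<noteq> d" for a b e d
  proof (cases "b = e")
    case False
    \<comment> \<open>Inserting the involution \<open>?t b e\<close> twice leaves two products whose
      factors share a point.\<close>
    have "?t a b \<circ> ?t e d = (?t a b \<circ> ?t b e) \<circ> (?t b e \<circ> ?t e d)"
      by (metis comp_assoc comp_id transpose_comp_involutory)
    then show ?thesis using False that K'(3) share by simp
  qed (use share that in simp)
  \<comment> \<open>Each transposition toggles the parity, so the induction has to carry a claim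
    about odd permutations along.\<close>
  have "(evenperm p \<longrightarrow> p \<in> K) \<and> (\<not> evenperm p \<longrightarrow> (\<forall>a\<in>S. \<forall>b\<in>S. a \<noteq> b \<longrightarrow> ?t a b \<circ> p \<in> K))"
    using p(1) S
  proof (induction rule: permutes_induct)
    case id
    then show ?case using K'(2) evenperm_id by blast
  next
    case (swap a b q)
    have par: "evenperm (?t a b \<circ> q) \<longleftrightarrow> \<not> evenperm q"
      using swap S by (simp add: evenperm_comp evenperm_swap permutation_swap_id permutes_imp_permutation)
    have "?t e d \<circ> (?t a b \<circ> q) \<in> K" if "evenperm q" "e \<in> S" "d \<in> S" "e \<noteq> d" for e d
      using K'(3)[OF two[of e d a b], of q] that swap by (simp add: comp_assoc)
    then show ?case using par swap by blast
  qed
  then show ?thesis using p(2) by blast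
qed

text \<open>One 3-cycle is enough: if h moves the triple x, y, z to u, v, w, then conjugating the
  given cycle by the inverse of h gives the cycle on x, y, z.\<close>

lemma three_transitive_contains_even:
  assumes K: "perm_group S K" and S: "finite S"
    and c: "cyc3 u v w \<in> K" "u \<noteq> v" "v \<noteq> w" "u \<noteq> w"
    and h: "\<And>x y z. \<lbrakk>x \<in> S; y \<in> S; z \<in> S; x \<noteq> y; y \<noteq> z; x \<noteq> z\<rbrakk>
        \<Longrightarrow> \<exists>h\<in>K. h x = u \<and> h y = v \<and> h z = w"
    and p: "p permutes S" "evenperm p"
  shows "p \<in> K"
proof (rule evenperm_in_perm_group[OF K S _ p])
  note K' = perm_groupD[OF K]
  fix x y z assume "x \<in> S" "y \<in> S" "z \<in> S" "x \<noteq> y" "y \<noteq> z" "x \<noteq> z"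
  then obtain h where h: "h \<in> K" "h x = u" "h y = v" "h z = w" using h by blast
  have b: "bij h" using K'(1)[OF h(1)] by (rule permutes_bij)
  then have i: "inv' h u = x" "inv' h v = y" "inv' h w = z"
    using h by (auto simp: bij_is_inj inv_f_eq)
  have "inv' h \<circ> cyc3 u v w \<circ> inv' (inv' h) = cyc3 x y z"
    using cyc3_conj[OF bij_imp_bij_inv[OF b]] i by simp
  moreover have "inv' h \<circ> cyc3 u v w \<circ> inv' (inv' h) \<in> K"
    using K'(3,4) h(1) c(1) by simp
  ultimately show "cyc3 x y z \<in> K" by simp
qed

text \<open>The supports of f and g share only x, so g fixes f x and f fixes g x; tracing a point
  through the four factors then gives the cycle. Nothing is asked of f and g away from x, so they
  may move many points.\<close>

lemma commutator_eq_cyc3: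
  assumes f: "bij f" and g: "bij g" and x: "f x \<noteq> x" "g x \<noteq> x"
    and only: "\<And>y. f y \<noteq> y \<Longrightarrow> g y \<noteq> y \<Longrightarrow> y = x"
  shows "f \<circ> g \<circ> inv' f \<circ> inv' g = cyc3 x (f x) (g x)"
proof
  fix w
  have fi: "f (inv' f y) = y" "inv' f (f y) = y" and gi: "g (inv' g y) = y" "inv' g (g y) = y" for y
    using f g by (simp_all add: bij_is_surj surj_f_inv_f bij_is_inj)
  have fx: "g (f x) = f x" "f (g x) = g x" "f x \<noteq> g x"
    using only x fi(2) gi(2) by metis+
  show "(f \<circ> g \<circ> inv' f \<circ> inv' g) w = cyc3 x (f x) (g x) w"
    unfolding cyc3_apply[OF x(1)[symmetric] fx(3) x(2)[symmetric]] o_def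
    using fi gi only x fx by metis
qed

section \<open>Extension of partial injections, and signs of blockwise permutations\<close>

text \<open>The complements of X and of its image have equal size, so f extends to a permutation.
  The two spare points outside X correct the parity if it is odd.\<close>

lemma even_extension:
  assumes S: "finite S" and X: "X \<subseteq> S" "card X + 2 \<le> card S"
    and f: "inj_on f X" "f ` X \<subseteq> S"
  obtains p where "p permutes S" "evenperm p" "\<And>x. x \<in> X \<Longrightarrow> p x = f x"
proof -
  have fin: "finite X" "finite (f ` X)" using S X f finite_subset by blast+
  have "card (S - X) = card (S - f ` X)"
    using S X f fin by (simp add: card_Diff_subset card_image)
  then obtain g where g: "bij_betw g (S - X) (S - f ` X)"
    using S finite_same_card_bij by blast
  define q where "q x = (if x \<in> X then f x else if x \<in> S then g x else x)" for x
  have "bij_betw q X (f ` X)"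
    using f(1) by (auto simp: q_def bij_betw_def inj_on_def)
  moreover have "bij_betw q (S - X) (S - f ` X)"
    using g by (subst bij_betw_cong[of _ _ g]) (auto simp: q_def)
  ultimately have "bij_betw q (X \<union> (S - X)) (f ` X \<union> (S - f ` X))"
    by (rule bij_betw_combine) blast
  moreover have "X \<union> (S - X) = S" "f ` X \<union> (S - f ` X) = S" using X f by blast+
  ultimately have q: "q permutes S" using X by (intro bij_imp_permutes) (auto simp: q_def)
  show ?thesis
  proof (cases "evenperm q")
    case True
    then show ?thesis using q that[of q] by (simp add: q_def)
  next
    case False
    have "2 \<le> card (S - X)" using S X fin by (simp add: card_Diff_subset)
    then obtain a b where ab: "a \<in> S - X" "b \<in> S - X" "a \<noteq> b"
      using card_le_Suc0_iff_eq[of "S - X"] S by fastforce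
    show ?thesis
    proof (rule that)
      show "q \<circ> Transposition.transpose a b permutes S"
        using ab q by (intro permutes_compose permutes_swap_id) auto
      show "evenperm (q \<circ> Transposition.transpose a b)"
        using ab q S False
        by (simp add: evenperm_comp evenperm_swap permutation_swap_id permutes_imp_permutation)
      show "(q \<circ> Transposition.transpose a b) x = f x" if "x \<in> X" for x
        proof -
        have "x \<noteq> a" "x \<noteq> b" using that ab by auto
        then show ?thesis using that by (simp add: q_def)
      qed
    qed
  qed
qed

text \<open>The map q acts as a copy of p on each of the disjoint blocks indexed by A, so it is a
  product of \<open>card A\<close> commuting copies of p, each with the sign of p.\<close>

lemma sign_blocks:
  assumes A: "finite A" and S: "finite S" and p: "p permutes S"
    and e: "\<And>a b x y. e a x = e b y \<Longrightarrow> a = b \<and> x = y"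
    and q: "\<And>a x. a \<in> A \<Longrightarrow> x \<in> S \<Longrightarrow> q (e a x) = e a (p x)"
      "\<And>w. w \<notin> (\<Union>a\<in>A. e a ` S) \<Longrightarrow> q w = w"
  shows "q permutes (\<Union>a\<in>A. e a ` S) \<and> sign q = sign p ^ card A"
  using A q
proof (induction A arbitrary: q rule: finite_induct)
  case empty
  then have "q = id" by (auto simp: fun_eq_iff)
  then show ?case using permutes_id by auto
next
  case (insert a A)
  define c where "c = map_permutation S (e a) p"
  \<comment> \<open>The induction peels off one block: \<open>c\<close> is the copy of p on block a,
    and \<open>r\<close> is q with that block made pointwise fixed.\<close>
  define r where "r w = (if w \<in> e a ` S then w else q w)" for w
  have inj: "inj_on (e a) S" using e by (auto intro: inj_onI)
  have r: "r permutes (\<Union>a\<in>A. e a ` S) \<and> sign r = sign p ^ card A"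
  proof (rule insert.IH)
    show "r (e b x) = e b (p x)" if "b \<in> A" "x \<in> S" for b x
      proof -
      have "e b x \<notin> e a ` S" using e that insert.hyps(2) by blast
      then show ?thesis using that insert.prems(1) by (simp add: r_def)
    qed
    show "r w = w" if "w \<notin> (\<Union>a\<in>A. e a ` S)" for w
      using that insert.prems(2) by (auto simp: r_def)
  qed
  have c: "c permutes e a ` S" "sign c = sign p"
    unfolding c_def using inj p S
    by (auto simp: map_permutation_permutes bij_betw_def sign_map_permutation)
  have "q = r \<circ> c"
  proof
    fix w
    show "q w = (r \<circ> c) w"
    proof (cases "w \<in> e a ` S")
      case True
      then obtain x where x: "x \<in> S" "w = e a x" by blast
      then have "c w = e a (p x)" by (simp add: c_def map_permutation_apply inj)
      then show ?thesis using x insert.prems(1)[of a x] p by (simp add: r_def permutes_in_image)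
    next
      case False
      then show ?thesis using c(1) by (simp add: permutes_not_in r_def)
    qed
  qed
  moreover have "r \<circ> c permutes (\<Union>a\<in>insert a A. e a ` S)"
    using r c(1) permutes_subset by (intro permutes_compose) (fastforce elim: permutes_subset)+
  moreover have "sign (r \<circ> c) = sign p ^ card (insert a A)"
    using r c S insert.hyps by (subst sign_compose) (auto intro!: permutes_imp_permutation[of "e a ` S" c] permutes_imp_permutation[of "\<Union>b\<in>A. e b ` S" r])
  ultimately show ?case by metis
qed

section \<open>Permutations of words extended by one letter\<close>

text \<open>Words of any other length are fixed, as membership in the permutations of
  \<open>words (Suc n)\<close> demands.\<close>

definition on_init :: "nat \<Rightarrow> ('a list \<Rightarrow> 'a list) \<Rightarrow> 'a list \<Rightarrow> 'a list" where
  "on_init n p w = (if length w = Suc n then p (butlast w) @ [last w] else w)"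

definition on_tail :: "nat \<Rightarrow> ('a list \<Rightarrow> 'a list) \<Rightarrow> 'a list \<Rightarrow> 'a list" where
  "on_tail n p w = (if length w = Suc n then hd w # p (tl w) else w)"

lemma mem_words [simp]: "w \<in> words n \<longleftrightarrow> length w = n"
  by (simp add: words_def)

lemma on_init_snoc [simp]: "length u = n \<Longrightarrow> on_init n p (u @ [s]) = p u @ [s]"
  by (simp add: on_init_def)

lemma on_tail_Cons [simp]: "length u = n \<Longrightarrow> on_tail n p (s # u) = s # p u"
  by (simp add: on_tail_def)

lemma on_init_other [simp]: "length w \<noteq> Suc n \<Longrightarrow> on_init n p w = w"
  by (simp add: on_init_def)

lemma on_tail_other [simp]: "length w \<noteq> Suc n \<Longrightarrow> on_tail n p w = w"
  by (simp add: on_tail_def)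

lemma finite_words: "finite (words n :: 'a::finite list set)"
  using finite_lists_length_eq[of "UNIV :: 'a set" n] by (simp add: words_def)

lemma card_words: "card (words n :: 'a::finite list set) = card (UNIV :: 'a set) ^ n"
  using card_lists_length_eq[of "UNIV :: 'a set" n] by (simp add: words_def)

lemma length_permutes_words: "p permutes words n \<Longrightarrow> length (p w) = length w"
  by (metis (no_types, lifting) mem_words permutes_in_image permutes_not_in)

text \<open>The words of length n + 1 fall into blocks according to their last letter, and each
  block carries a copy of p. The parity of the alphabet size therefore decides what happens to odd
  p.\<close>

lemma on_init_permutes_sign:
  fixes p :: "'a::finite list \<Rightarrow> 'a list"
  assumes p: "p permutes words n"
  shows "on_init n p permutes words (Suc n)"
    and "sign (on_init n p) = sign p ^ card (UNIV :: 'a set)"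
proof -
  have U: "(\<Union>s. (\<lambda>u. u @ [s]) ` words n) = (words (Suc n) :: 'a list set)"
    by (auto simp: length_Suc_conv_rev image_iff)
  have "on_init n p permutes (\<Union>s\<in>UNIV. (\<lambda>u. u @ [s]) ` words n)
      \<and> sign (on_init n p) = sign p ^ card (UNIV :: 'a set)"
    by (rule sign_blocks[OF finite finite_words p]) (auto simp: U)
  then show "on_init n p permutes words (Suc n)"
    "sign (on_init n p) = sign p ^ card (UNIV :: 'a set)" by (simp_all add: U)
qed

lemma on_tail_permutes_sign:
  fixes p :: "'a::finite list \<Rightarrow> 'a list"
  assumes p: "p permutes words n"
  shows "on_tail n p permutes words (Suc n)"
    and "sign (on_tail n p) = sign p ^ card (UNIV :: 'a set)"
proof -
  have U: "(\<Union>s. (\<lambda>u. s # u) ` words n) = (words (Suc n) :: 'a list set)"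
    by (auto simp: length_Suc_conv image_iff)
  have "on_tail n p permutes (\<Union>s\<in>UNIV. (\<lambda>u. s # u) ` words n)
      \<and> sign (on_tail n p) = sign p ^ card (UNIV :: 'a set)"
    by (rule sign_blocks[OF finite finite_words p]) (auto simp: U)
  then show "on_tail n p permutes words (Suc n)"
    "sign (on_tail n p) = sign p ^ card (UNIV :: 'a set)" by (simp_all add: U)
qed

text \<open>Two 3-cycles, one lifted to the first n letters and one to the last n, have supports
  meeting in one word; their commutator is a 3-cycle on words of length n + 1. Transitivity on
  triples then yields all even permutations.\<close>

lemma even_words_step:
  fixes K :: "('a::finite list \<Rightarrow> 'a list) set"
  assumes K: "perm_group (words (Suc n)) K" and n: "4 \<le> n" and k: "2 \<le> card (UNIV :: 'a set)"
    and ini: "\<And>p. p permutes words n \<Longrightarrow> evenperm p \<Longrightarrow> on_init n p \<in> K"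
    and tai: "\<And>p. p permutes words n \<Longrightarrow> evenperm p \<Longrightarrow> on_tail n p \<in> K"
    and p: "p permutes words (Suc n)" "evenperm p"
  shows "p \<in> K"
proof -
  note K' = perm_groupD[OF K]
  obtain m where m: "n = Suc m" using n by (cases n) auto
  \<comment> \<open>Used for j = m to find five inner words, and for j = n to leave two spare words
    beside at most three prescribed ones.\<close>
  have pow: "5 \<le> card (words j :: 'a list set)" if "3 \<le> j" for j
  proof -
    have "(2::nat) ^ 3 \<le> 2 ^ j" using that by (rule power_increasing) simp
    also have "\<dots> \<le> card (UNIV :: 'a set) ^ j" using k by (rule power_mono) simp
    finally show ?thesis by (simp add: card_words)
  qed
  obtain X where X: "X \<subseteq> (words m :: 'a list set)" "card X = 5"
    using obtain_subset_with_card_n[OF pow[of m]] n m by auto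
  obtain xs where xs: "set xs = X" "distinct xs"
    using finite_distinct_list[OF finite_subset[OF X(1) finite_words]] by blast
  have "length xs = 5" using xs X by (metis distinct_card)
  then have "length xs = Suc (Suc (Suc (Suc (Suc 0))))" by simp
  then obtain r r1 r2 q1 q2 where xs5: "xs = [r, r1, r2, q1, q2]"
    unfolding length_Suc_conv by fastforce
  have len: "length r = m" "length r1 = m" "length r2 = m" "length q1 = m" "length q2 = m"
    using X(1) unfolding xs(1)[symmetric] xs5 by simp_all
  have dist: "distinct [r, r1, r2, q1, q2]" using xs(2) unfolding xs5 .
  define a :: 'a where "a = undefined"
  define f where "f = on_init n (cyc3 (a # r) (a # r1) (a # r2))"
  define g where "g = on_tail n (cyc3 (r @ [a]) (q1 @ [a]) (q2 @ [a]))"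
  have fK: "f \<in> K" unfolding f_def using len dist m
    by (intro ini cyc3_permutes evenperm_cyc3) auto
  have gK: "g \<in> K" unfolding g_def using len dist m
    by (intro tai cyc3_permutes evenperm_cyc3) auto
  define x where "x = a # r @ [a]"
  have fx: "f x = a # r1 @ [a]"
    using on_init_snoc[of "a # r" n "cyc3 (a # r) (a # r1) (a # r2)" a] len dist m
    by (simp add: f_def x_def cyc3_apply)
  have gx: "g x = a # q1 @ [a]"
    using len dist m by (simp add: g_def x_def cyc3_apply)
  have "f \<circ> g \<circ> inv' f \<circ> inv' g = cyc3 x (f x) (g x)"
  proof (rule commutator_eq_cyc3)
    show "bij f" "bij g" using K'(1) fK gK permutes_bij by blast+
    show "f x \<noteq> x" "g x \<noteq> x" using fx gx dist by (auto simp: x_def)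
    \<comment> \<open>A word moved by f starts with a and has inner part r, r1 or r2; one moved by g
      ends with a and has inner part r, q1 or q2. Only a r a meets both descriptions.\<close>
    fix y assume fy: "f y \<noteq> y" and gy: "g y \<noteq> y"
    have "length y = Suc n" using fy by (auto simp: f_def intro: ccontr)
    then obtain s y' where y': "y = s # y'" "length y' = Suc m" by (auto simp: length_Suc_conv m)
    then obtain v t where "y' = v @ [t]" and v: "length v = m" by (auto simp: length_Suc_conv_rev)
    then have y: "y = s # v @ [t]" using y' by simp
    have "s # v \<in> {a # r, a # r1, a # r2}"
      using fy on_init_snoc[of "s # v" n _ t] v m dist
      by (auto simp: f_def y cyc3_apply split: if_splits)
    moreover have "v @ [t] \<in> {r @ [a], q1 @ [a], q2 @ [a]}"
      using gy v m dist by (auto simp: g_def y cyc3_apply split: if_splits)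
    ultimately show "y = x" using dist by (auto simp: y x_def)
  qed
  then have c: "cyc3 x (f x) (g x) \<in> K" using K'(3,4) fK gK by metis
  show ?thesis
  proof (rule three_transitive_contains_even[OF K finite_words c _ _ _ _ p])
    show "x \<noteq> f x" "f x \<noteq> g x" "x \<noteq> g x" unfolding fx gx using dist by (auto simp: x_def)
    fix u v w :: "'a list"
    assume uvw: "u \<in> words (Suc n)" "v \<in> words (Suc n)" "w \<in> words (Suc n)"
      and ne: "u \<noteq> v" "v \<noteq> w" "u \<noteq> w"
    \<comment> \<open>First move \<open>u\<close>, \<open>v\<close>, \<open>w\<close> to words that begin with the same letter; their tails are then
      distinct, so that a permutation of the tails finishes the job.\<close>
    define B where "B = {butlast u, butlast v, butlast w}"
    have B: "finite B" "card B \<le> 3" "B \<subseteq> words n"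
      using uvw by (auto simp: B_def card_insert_if)
    have im: "card ((#) a ` words m) = card (words m :: 'a list set)"
      by (rule card_image) simp
    \<comment> \<open>B can have fewer than three elements, since u, v, w may differ only in the
      last letter; \<open>on_init\<close> keeps that letter, so their images stay distinct
      anyway.\<close>
    have "card B \<le> card ((#) a ` words m)"
      using B(2) pow[of m] n unfolding im by (simp add: m)
    then obtain f1 where f1: "f1 ` B \<subseteq> (#) a ` words m" "inj_on f1 B"
      using card_le_inj[OF B(1) finite_imageI[OF finite_words]] by blast
    have "card B + 2 \<le> card (words n :: 'a list set)" using B(2) pow[of n] n by simp
    moreover have "f1 ` B \<subseteq> words n" using f1(1) m by auto
    ultimately obtain p1 where p1: "p1 permutes words n" "evenperm p1" "\<And>x. x \<in> B \<Longrightarrow> p1 x = f1 x"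
      using even_extension[OF finite_words B(3) _ f1(2)] by blast
    define h1 where "h1 = on_init n p1"
    have h1K: "h1 \<in> K" unfolding h1_def using p1 ini by blast
    have inj1: "inj h1" using K'(1)[OF h1K] by (rule permutes_inj)
    have h1: "\<exists>t. h1 y = a # t \<and> length t = n" if "y \<in> {u, v, w}" for y
    proof -
      have y: "length y = Suc n" "butlast y \<in> B" using that uvw by (auto simp: B_def)
      then have "p1 (butlast y) \<in> (#) a ` words m" using p1(3) f1(1) by auto
      then show ?thesis using y by (auto simp: h1_def on_init_def m)
    qed
    obtain tu tv tw where t: "h1 u = a # tu" "h1 v = a # tv" "h1 w = a # tw"
      and tl: "length tu = n" "length tv = n" "length tw = n"
      using h1[of u] h1[of v] h1[of w] by auto
    have tne: "tu \<noteq> tv" "tv \<noteq> tw" "tu \<noteq> tw"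
      using ne inj1 t unfolding inj_def by metis+
    \<comment> \<open>These targets are the tails of \<open>x\<close>, \<open>f x\<close> and
      \<open>g x\<close>.\<close>
    define f2 where "f2 y = (if y = tu then r @ [a] else if y = tv then r1 @ [a] else q1 @ [a])" for y
    have C: "{tu, tv, tw} \<subseteq> words n" "card {tu, tv, tw} + 2 \<le> card (words n :: 'a list set)"
      using tl tne pow[of n] n by auto
    have "inj_on f2 {tu, tv, tw}" "f2 ` {tu, tv, tw} \<subseteq> words n"
      using dist tne len m by (auto simp: f2_def inj_on_def)
    then obtain p2 where p2: "p2 permutes words n" "evenperm p2"
      "\<And>x. x \<in> {tu, tv, tw} \<Longrightarrow> p2 x = f2 x"
      using even_extension[OF finite_words C] by blast
    define h2 where "h2 = on_tail n p2"
    have "h2 \<in> K" unfolding h2_def using p2 tai by blast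
    then have "h2 \<circ> h1 \<in> K" using K'(3) h1K by blast
    moreover have "(h2 \<circ> h1) u = x" "(h2 \<circ> h1) v = f x" "(h2 \<circ> h1) w = g x"
      unfolding fx gx using t tl p2(3) tne by (auto simp: h2_def f2_def x_def)
    ultimately show "\<exists>h\<in>K. h u = x \<and> h v = f x \<and> h w = g x" by blast
  qed
qed

section \<open>Adjacent transpositions, rotation, and induction on the word length\<close>

lemma transp_adjacent:
  assumes "length u = i"
  shows "transp (Suc i) (Suc (Suc i)) (u @ x # y # v) = Some (u @ y # x # v)"
  using assms by (auto simp: transp_def list_update_append nth_append)

lemma action_outside [simp]: "length w \<noteq> n \<Longrightarrow> action n f w = w"
  by (simp add: action_def)

text \<open>Adjacent transpositions carry the first letter to the right one place at a time. The
  case j = n is the full rotation; the smaller j serve the induction.\<close>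

lemma rotation_in_perm_group:
  assumes K: "perm_group (words (Suc n)) K"
    and sw: "\<And>i. 1 \<le> i \<Longrightarrow> i \<le> n \<Longrightarrow> action (Suc n) (transp i (i + 1)) \<in> K"
    and j: "j \<le> n"
  shows "\<exists>\<rho>\<in>K. \<forall>s u v. length u = j \<longrightarrow> length (u @ v) = n \<longrightarrow> \<rho> (s # u @ v) = u @ s # v"
  using j
proof (induction j)
  case 0
  then show ?case using perm_groupD(2)[OF K] by (intro bexI[of _ id]) auto
next
  case (Suc j)
  then obtain \<rho> where \<rho>: "\<rho> \<in> K"
    "\<And>s u v. length u = j \<Longrightarrow> length (u @ v) = n \<Longrightarrow> \<rho> (s # u @ v) = u @ s # v"
    by force
  \<comment> \<open>After j moves the travelling letter has j letters before it, hence position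
    \<open>Suc j\<close> when counting from 1.\<close>
  let ?t = "action (Suc n) (transp (Suc j) (Suc (Suc j)))"
  have "?t \<in> K" using sw[of "Suc j"] Suc.prems by simp
  moreover have "(?t \<circ> \<rho>) (s # u @ v) = u @ s # v" if "length u = Suc j" "length (u @ v) = n" for s u v
  proof -
    obtain u' y where u: "u = u' @ [y]" "length u' = j"
      using \<open>length u = Suc j\<close> by (auto simp: length_Suc_conv_rev)
    then have "\<rho> (s # u @ v) = u' @ s # y # v" using \<rho>(2)[of u' "y # v" s] that by simp
    then show ?thesis using that u by (simp add: action_def transp_adjacent)
  qed
  ultimately show ?case using perm_groupD(3)[OF K _ \<rho>(1)] by blast
qed

text \<open>Conjugation by the rotation that moves the first letter to the end exchanges the two
  ways of letting p act.\<close>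

lemma on_tail_in_perm_group:
  assumes K: "perm_group (words (Suc n)) K"
    and sw: "\<And>i. 1 \<le> i \<Longrightarrow> i \<le> n \<Longrightarrow> action (Suc n) (transp i (i + 1)) \<in> K"
    and p: "p permutes words n" "on_init n p \<in> K"
  shows "on_tail n p \<in> K"
proof -
  note K' = perm_groupD[OF K]
  obtain \<rho> where \<rho>: "\<rho> \<in> K" "\<And>s u. length u = n \<Longrightarrow> \<rho> (s # u) = u @ [s]"
    using rotation_in_perm_group[OF K sw order_refl] by (metis append_Nil2)
  have \<rho>p: "\<rho> permutes words (Suc n)" using K'(1) \<rho>(1) by blast
  have "on_tail n p = inv' \<rho> \<circ> on_init n p \<circ> \<rho>"
  proof
    fix w
    show "on_tail n p w = (inv' \<rho> \<circ> on_init n p \<circ> \<rho>) w"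
    proof (cases "length w = Suc n")
      case True
      then obtain s u where w: "w = s # u" "length u = n" by (auto simp: length_Suc_conv)
      have "inv' \<rho> (p u @ [s]) = s # p u"
        using \<rho>(2)[of "p u" s] length_permutes_words[OF p(1)] w
        by (metis \<rho>p permutes_inverses(2))
      then show ?thesis using w \<rho>(2) by simp
    next
      case False
      then have "\<rho> w = w" "inv' \<rho> w = w"
        using \<rho>p permutes_inv[OF \<rho>p] by (simp_all add: permutes_not_in)
      then show ?thesis using False by simp
    qed
  qed
  then show ?thesis using K'(3,4) \<rho>(1) p(2) by simp
qed

text \<open>Induction on n from 4, stated for an arbitrary family of groups. Assumption
  \<open>up\<close> gives the action on the first n letters, and rotation gives that on the last
  n.\<close>

lemma even_words_in_perm_groups:
  fixes K :: "nat \<Rightarrow> ('a::finite list \<Rightarrow> 'a list) set"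
  assumes K: "\<And>n. 4 \<le> n \<Longrightarrow> perm_group (words n) (K n)" and k: "2 \<le> card (UNIV :: 'a set)"
    and sw: "\<And>n i. 4 \<le> n \<Longrightarrow> 1 \<le> i \<Longrightarrow> i < n \<Longrightarrow> action n (transp i (i + 1)) \<in> K n"
    and up: "\<And>n p. 4 \<le> n \<Longrightarrow> p \<in> K n \<Longrightarrow> on_init n p \<in> K (Suc n)"
    and base: "\<And>p. p permutes words 4 \<Longrightarrow> evenperm p \<Longrightarrow> p \<in> K 4"
    and n: "4 \<le> n" and p: "p permutes words n" "evenperm p"
  shows "p \<in> K n"
  using n p
proof (induction n arbitrary: p rule: dec_induct)
  case base
  then show ?case using assms(5) by simp
next
  case (step n)
  have K1: "perm_group (words (Suc n)) (K (Suc n))" using K step.hyps by simp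
  have ini: "on_init n q \<in> K (Suc n)" if "q permutes words n" "evenperm q" for q
    using up step.hyps step.IH that by blast
  have "on_tail n q \<in> K (Suc n)" if "q permutes words n" "evenperm q" for q
    using that ini sw step.hyps by (intro on_tail_in_perm_group[OF K1]) auto
  then show ?case using even_words_step[OF K1 step.hyps(1) k ini] step.prems by blast
qed

section \<open>The alternating group on four bits\<close>

definition flip4 :: "nat \<Rightarrow> bit list \<Rightarrow> bit list" where
  "flip4 i w = (if length w = 4 then w[i := w ! i + 1] else w)"

text \<open>For distinct indices this is an elementary transvection of the four-dimensional space
  over the field with two elements: a controlled not with control i and target j, counted from
  0.\<close>

definition add4 :: "nat \<Rightarrow> nat \<Rightarrow> bit list \<Rightarrow> bit list" where
  "add4 i j w = (if length w = 4 then w[j := w ! j + w ! i] else w)"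

lemma words4_cases:
  assumes "length w = 4"
  obtains a b c d where "w = [a, b, c, d]"
  using assms by (auto simp: numeral_eq_Suc length_Suc_conv)

lemma ext_words4:
  assumes "\<And>a b c d. f [a, b, c, d] = g [a, b, c, d]" "\<And>w. length w \<noteq> 4 \<Longrightarrow> f w = g w"
  shows "f = g"
  using assms by (metis ext words4_cases)

lemma swap4_simps:
  "action 4 (transp (Suc 0) 2) [a, b, c, d] = [b, a, c, d]"
  "action 4 (transp 2 3) [a, b, c, d] = [a, c, b, d]"
  "action 4 (transp 3 4) [a, b, c, d] = [a, b, d, c]"
  by (simp_all add: action_def transp_def)

text \<open>Over the field with two elements any three distinct points are affinely independent, so
  affine maps are transitive on triples. Flips and transvections realise the maps needed, and
  Toffoli gates give the 3-cycle.\<close>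

lemma even_words4_bit:
  assumes K: "perm_group (words 4) K"
    and g: "action 4 not_gate \<in> K" "action 4 cnot_gate \<in> K" "action 4 toffoli_gate \<in> K"
    and sw: "\<And>i. 1 \<le> i \<Longrightarrow> i < 4 \<Longrightarrow> action 4 (transp i (i + 1)) \<in> K"
    and p: "p permutes words 4" "evenperm p"
  shows "p \<in> K"
proof -
  note K' = perm_groupD[OF K]
  let ?s1 = "action 4 (transp (Suc 0) 2) :: bit list \<Rightarrow> bit list"
  let ?s2 = "action 4 (transp 2 3) :: bit list \<Rightarrow> bit list"
  let ?s3 = "action 4 (transp 3 4) :: bit list \<Rightarrow> bit list"
  have s: "?s1 \<in> K" "?s2 \<in> K" "?s3 \<in> K"
    using sw[of 1] sw[of 2] sw[of 3] by (simp_all add: numeral_eq_Suc)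
  have conj: "s \<circ> f \<circ> s \<in> K" if "s \<in> K" "f \<in> K" for s f using K'(3) that by simp
  have opt: "(if P then f else id) \<in> K" if "f \<in> K" for P f using that K'(2) by simp
  have F0: "flip4 0 \<in> K"
  proof -
    have "flip4 0 = action 4 not_gate"
      by (rule ext_words4) (auto simp: flip4_def action_def)
    then show ?thesis using g by simp
  qed
  have F: "flip4 1 = ?s1 \<circ> flip4 0 \<circ> ?s1" "flip4 2 = ?s2 \<circ> flip4 1 \<circ> ?s2"
    "flip4 3 = ?s3 \<circ> flip4 2 \<circ> ?s3"
    by (rule ext_words4; simp add: flip4_def swap4_simps)+
  have flip: "flip4 0 \<in> K" "flip4 1 \<in> K" "flip4 2 \<in> K" "flip4 3 \<in> K"
    using F F0 conj s by metis+
  have A01: "add4 0 1 \<in> K"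
  proof -
    have "add4 0 1 = action 4 cnot_gate"
      by (rule ext_words4) (auto simp: add4_def action_def)
    then show ?thesis using g by simp
  qed
  \<comment> \<open>Conjugating by swaps of neighbouring bits moves the control and the target
    wherever they are needed.\<close>
  have A: "add4 1 0 = ?s1 \<circ> add4 0 1 \<circ> ?s1" "add4 0 2 = ?s2 \<circ> add4 0 1 \<circ> ?s2"
    "add4 0 3 = ?s3 \<circ> add4 0 2 \<circ> ?s3" "add4 1 2 = ?s1 \<circ> add4 0 2 \<circ> ?s1"
    "add4 2 0 = ?s2 \<circ> add4 1 0 \<circ> ?s2" "add4 2 1 = ?s1 \<circ> add4 2 0 \<circ> ?s1"
    "add4 3 0 = ?s3 \<circ> add4 2 0 \<circ> ?s3" "add4 3 1 = ?s1 \<circ> add4 3 0 \<circ> ?s1"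
    "add4 3 2 = ?s2 \<circ> add4 3 1 \<circ> ?s2" "add4 1 3 = ?s1 \<circ> add4 0 3 \<circ> ?s1"
    "add4 2 3 = ?s2 \<circ> add4 1 3 \<circ> ?s2"
    by (rule ext_words4; simp add: add4_def swap4_simps)+
  have add: "add4 1 0 \<in> K" "add4 0 2 \<in> K" "add4 0 3 \<in> K" "add4 1 2 \<in> K" "add4 2 0 \<in> K"
    "add4 2 1 \<in> K" "add4 3 0 \<in> K" "add4 3 2 \<in> K" "add4 2 3 \<in> K"
    using A A01 conj s by metis+
  \<comment> \<open>Negating both controls makes f flip bit 2 exactly when bits 0 and 1 vanish. The
    conjugate g, by the exchange of the two halves of the word, flips bit 0 when bits 2 and 3
    vanish; the supports meet in the zero vector only.\<close>
  define f where "f = (flip4 0 \<circ> flip4 1) \<circ> action 4 toffoli_gate \<circ> (flip4 0 \<circ> flip4 1)"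
  define g where "g = (?s2 \<circ> ?s1 \<circ> ?s3 \<circ> ?s2) \<circ> f \<circ> (?s2 \<circ> ?s1 \<circ> ?s3 \<circ> ?s2)"
  have fK: "f \<in> K" unfolding f_def using conj K'(3) flip assms(4) by metis
  have gK: "g \<in> K" unfolding g_def
    by (rule conj[OF _ fK]) (intro K'(3) s)
  have f: "f [a, b, c, d] = [a, b, c + (b + 1) * (a + 1), d]" for a b c d
    by (cases a; cases b) (simp_all add: f_def flip4_def action_def)
  have g: "g [a, b, c, d] = [a + (d + 1) * (c + 1), b, c, d]" for a b c d
    by (simp add: g_def f swap4_simps)
  define Z :: "bit list" where "Z = [0, 0, 0, 0]"
  have fZ: "f Z = [0, 0, 1, 0]" and gZ: "g Z = [1, 0, 0, 0]" by (simp_all add: Z_def f g)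
  have "f \<circ> g \<circ> inv' f \<circ> inv' g = cyc3 Z (f Z) (g Z)"
  proof (rule commutator_eq_cyc3)
    show "bij f" "bij g" using K'(1) fK gK permutes_bij by blast+
    show "f Z \<noteq> Z" "g Z \<noteq> Z" by (simp_all add: fZ gZ) (simp_all add: Z_def)
    fix y assume y: "f y \<noteq> y" "g y \<noteq> y"
    then have "length y = 4" using K'(1)[OF fK] by (metis mem_words permutes_not_in)
    then obtain a b c d where "y = [a, b, c, d]" by (rule words4_cases)
    then show "y = Z" using y by (cases a; cases b; cases c; cases d) (simp_all add: f g Z_def)
  qed
  then have c: "cyc3 Z (f Z) (g Z) \<in> K" using K'(3,4) fK gK by metis
  show ?thesis
  proof (rule three_transitive_contains_even[OF K finite_words c _ _ _ _ p])
    show "Z \<noteq> f Z" "f Z \<noteq> g Z" "Z \<noteq> g Z" unfolding fZ gZ by (simp_all add: Z_def)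
    fix x y z :: "bit list"
    assume xyz: "x \<in> words 4" "y \<in> words 4" "z \<in> words 4" and ne: "x \<noteq> y" "y \<noteq> z" "x \<noteq> z"
    \<comment> \<open>The translation by x; the maps that follow are linear and therefore keep
      \<open>Z\<close> fixed.\<close>
    obtain h1 where h1: "h1 \<in> K" "h1 x = Z"
    proof
      show "(if x ! 3 = 1 then flip4 3 else id) \<circ> (if x ! 2 = 1 then flip4 2 else id)
        \<circ> (if x ! 1 = 1 then flip4 1 else id) \<circ> (if x ! 0 = 1 then flip4 0 else id) \<in> K" (is "?h \<in> K")
        by (intro K'(3) opt flip)
      obtain a b c d where "x = [a, b, c, d]" using xyz(1) words4_cases by (metis mem_words)
      then show "?h x = Z"
        by (cases a; cases b; cases c; cases d) (simp_all add: flip4_def Z_def)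
    qed
    have h1': "length (h1 w) = length w" "inj h1" for w
      using K'(1)[OF h1(1)] length_permutes_words permutes_inj by blast+
    obtain a b c d where y1: "h1 y = [a, b, c, d]" using xyz(2) h1' words4_cases by (metis mem_words)
    have y1ne: "[a, b, c, d] \<noteq> Z" using ne h1 h1'(2) y1 by (metis inj_eq)
    \<comment> \<open>Elimination with bit 2 as pivot: the innermost factor makes this bit 1 by
      adding a non-zero bit to it, and the others clear the rest.\<close>
    obtain h2 where h2: "h2 \<in> K" "h2 Z = Z" "h2 (h1 y) = f Z"
    proof
      show "(if a = 1 then add4 2 0 else id) \<circ> (if b = 1 then add4 2 1 else id)
        \<circ> (if d = 1 then add4 2 3 else id) \<circ>
        (if c = 0 then (if a = 1 then add4 0 2 else if b = 1 then add4 1 2 else add4 3 2) else id) \<in> K"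
        (is "?h \<in> K")
        using add K'(2) by (intro K'(3)) auto
      show "?h Z = Z" by (simp add: Z_def add4_def)
      show "?h (h1 y) = f Z" using y1ne unfolding y1 fZ
        by (cases a; cases b; cases c; cases d) (simp_all add: add4_def Z_def)
    qed
    have h2': "length (h2 w) = length w" "inj h2" for w
      using K'(1)[OF h2(1)] length_permutes_words permutes_inj by blast+
    obtain a b c d where z1: "h2 (h1 z) = [a, b, c, d]"
      using xyz(3) h1' h2' words4_cases by (metis mem_words)
    have z1ne: "[a, b, c, d] \<noteq> Z" "[a, b, c, d] \<noteq> f Z"
      using ne h1 h1'(2) h2 h2'(2) z1 by (metis inj_eq)+
    \<comment> \<open>The same with bit 0 as pivot, never adding bit 2 to another bit, so that
      \<open>f Z\<close> stays fixed. A non-zero bit other than bit 2 exists because the vector is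
      neither \<open>Z\<close> nor \<open>f Z\<close>.\<close>
    obtain h3 where h3: "h3 \<in> K" "h3 Z = Z" "h3 (f Z) = f Z" "h3 (h2 (h1 z)) = g Z"
    proof
      show "(if b = 1 then add4 0 1 else id) \<circ> (if c = 1 then add4 0 2 else id)
        \<circ> (if d = 1 then add4 0 3 else id) \<circ>
        (if a = 0 then (if b = 1 then add4 1 0 else add4 3 0) else id) \<in> K"
        (is "?h \<in> K")
        using add A01 K'(2) by (intro K'(3)) auto
      show "?h Z = Z" by (simp add: Z_def add4_def)
      show "?h (f Z) = f Z" by (simp add: fZ add4_def)
      show "?h (h2 (h1 z)) = g Z" using z1ne unfolding z1 fZ gZ
        by (cases a; cases b; cases c; cases d) (simp_all add: add4_def Z_def)
    qed
    show "\<exists>h\<in>K. h x = Z \<and> h y = f Z \<and> h z = g Z"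
      using h1 h2 h3 K'(3) by (intro bexI[of _ "h3 \<circ> h2 \<circ> h1"]) auto
  qed
qed

section \<open>Permutations of words as elements of the Thompson-Higman group\<close>

lemma essential_riI:
  assumes "right_ideal R" "\<And>x. \<exists>z. x @ z \<in> R"
  shows "essential_ri R"
  unfolding essential_ri_def
proof (intro conjI allI impI)
  fix I :: "'a list set" assume I: "right_ideal I \<and> I \<noteq> {}"
  then obtain x where "x \<in> I" by blast
  moreover obtain z where "x @ z \<in> R" using assms(2) by blast
  ultimately show "R \<inter> I \<noteq> {}" using I unfolding right_ideal_def by blast
qed (fact assms(1))

text \<open>Any word can be extended into the domain of the inner map and its image then into that
  of the outer map, so the domain of the composition is essential. The range is treated in the same
  way, backwards.\<close>

lemma ess_iso_comp:
  assumes f: "ess_iso \<phi>" and g: "ess_iso \<psi>"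
  shows "ess_iso (\<phi> \<circ>\<^sub>m \<psi>)"
proof -
  note f' = ess_isoD[OF f] and g' = ess_isoD[OF g]
  have e: "(\<phi> \<circ>\<^sub>m \<psi>) x = Some y \<longleftrightarrow> (\<exists>v. \<psi> x = Some v \<and> \<phi> v = Some y)" for x y
    by (auto simp: map_comp_def split: option.splits)
  have h: "(\<phi> \<circ>\<^sub>m \<psi>) (x @ z) = Some (y @ z)" if "(\<phi> \<circ>\<^sub>m \<psi>) x = Some y" for x y z
    using that f'(3) g'(3) unfolding e by blast
  show ?thesis
  proof (rule ess_isoI)
    show "essential_ri (dom (\<phi> \<circ>\<^sub>m \<psi>))"
    proof (rule essential_riI)
      show "right_ideal (dom (\<phi> \<circ>\<^sub>m \<psi>))" using h unfolding right_ideal_def by blast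
      fix x
      obtain z v where v: "\<psi> (x @ z) = Some v" using essential_ri_extend[OF g'(1)] by blast
      obtain u y where "\<phi> (v @ u) = Some y" using essential_ri_extend[OF f'(1)] by blast
      then have "(\<phi> \<circ>\<^sub>m \<psi>) ((x @ z) @ u) = Some y" using g'(3)[OF v] e by blast
      then show "\<exists>z. x @ z \<in> dom (\<phi> \<circ>\<^sub>m \<psi>)" by (metis append_assoc domI)
    qed
    show "essential_ri (ran (\<phi> \<circ>\<^sub>m \<psi>))"
    proof (rule essential_riI)
      show "right_ideal (ran (\<phi> \<circ>\<^sub>m \<psi>))" using h unfolding right_ideal_def ran_def by blast
      fix y
      obtain z where "y @ z \<in> ran \<phi>" using essential_ri_extend[OF f'(2)] by blast
      then obtain v where v: "\<phi> v = Some (y @ z)" by (auto simp: ran_def)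
      obtain u where "v @ u \<in> ran \<psi>" using essential_ri_extend[OF g'(2)] by blast
      then obtain x where "\<psi> x = Some (v @ u)" by (auto simp: ran_def)
      then have "(\<phi> \<circ>\<^sub>m \<psi>) x = Some (y @ z @ u)" using f'(3)[OF v, of u] e by simp
      then show "\<exists>z. y @ z \<in> ran (\<phi> \<circ>\<^sub>m \<psi>)" by (auto simp: ran_def)
    qed
    show "x = x'" if "(\<phi> \<circ>\<^sub>m \<psi>) x = Some y" "(\<phi> \<circ>\<^sub>m \<psi>) x' = Some y" for x x' y
      using that f'(4) g'(4) unfolding e by blast
  qed (fact h)
qed

lemma is_max_ext_max_ext: "ess_iso \<phi> \<Longrightarrow> is_max_ext \<phi> (max_ext \<phi>)"
  unfolding max_ext_def by (rule theI'[OF is_max_ext_ex1])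

lemma max_extD:
  assumes "ess_iso \<phi>"
  shows "ess_iso (max_ext \<phi>)" "\<phi> \<subseteq>\<^sub>m max_ext \<phi>"
  using is_max_ext_max_ext[OF assms] unfolding is_max_ext_def by blast+

text \<open>By uniqueness, since the maximal extension of \<chi> also extends \<phi> maximally.
  Elements of the group can thus be compared on any smaller essential right ideal.\<close>

lemma max_ext_eq_if_map_le:
  assumes "ess_iso \<phi>" "ess_iso \<chi>" "\<phi> \<subseteq>\<^sub>m \<chi>"
  shows "max_ext \<phi> = max_ext \<chi>"
proof -
  have "is_max_ext \<phi> (max_ext \<chi>)"
    using is_max_ext_max_ext[OF assms(2)] assms(3) map_le_trans unfolding is_max_ext_def by blast
  then show ?thesis using is_max_ext_ex1[OF assms(1)] is_max_ext_max_ext[OF assms(1)] by blast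
qed

lemma max_ext_max_ext: "ess_iso \<phi> \<Longrightarrow> max_ext (max_ext \<phi>) = max_ext \<phi>"
  using max_ext_eq_if_map_le max_extD by metis

lemma map_comp_mono: "f \<subseteq>\<^sub>m f' \<Longrightarrow> g \<subseteq>\<^sub>m g' \<Longrightarrow> f \<circ>\<^sub>m g \<subseteq>\<^sub>m f' \<circ>\<^sub>m g'"
  unfolding map_le_def map_comp_def dom_def by (fastforce split: option.splits)

lemma ess_iso_Some: "ess_iso (Some :: 'a::finite list \<rightharpoonup> 'a list)"
proof (rule ess_isoI)
  have "essential_ri (UNIV :: 'a list set)" by (rule essential_riI) (auto simp: right_ideal_def)
  moreover have "ran (Some :: 'a list \<rightharpoonup> 'a list) = UNIV" "dom (Some :: 'a list \<rightharpoonup> 'a list) = UNIV"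
    by (auto simp: ran_def)
  ultimately show "essential_ri (dom (Some :: 'a list \<rightharpoonup> 'a list))"
    "essential_ri (ran (Some :: 'a list \<rightharpoonup> 'a list))" by simp_all
qed auto

lemma max_ext_Some: "max_ext Some = Some"
  using max_extD(2)[OF ess_iso_Some] by (metis map_le_def domI ext)

section \<open>Group elements represented by permutations of words\<close>

definition lift :: "nat \<Rightarrow> ('a::finite list \<Rightarrow> 'a list) \<Rightarrow> ('a list \<rightharpoonup> 'a list)" where
  "lift n p w = (if n \<le> length w then Some (p (take n w) @ drop n w) else None)"

abbreviation elem :: "nat \<Rightarrow> ('a::finite list \<Rightarrow> 'a list) \<Rightarrow> ('a list \<rightharpoonup> 'a list)" where
  "elem n p \<equiv> max_ext (lift n p)"

text \<open>The domain and the range are both the right ideal generated by the finite set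
  \<open>words n\<close>.\<close>

lemma fin_gen_ess_iso_lift:
  assumes p: "p permutes words n"
  shows "fin_gen_ess_iso (lift n p)"
proof -
  let ?R = "{w :: 'a list. n \<le> length w}"
  have len: "length (p w) = length w" "length (inv' p w) = length w" for w
    using length_permutes_words p permutes_inv[OF p] by blast+
  have "?R = {c @ z | c z. c \<in> words n}"
  proof
    show "?R \<subseteq> {c @ z | c z. c \<in> words n}"
    proof
      fix w assume "w \<in> ?R"
      then have "take n w \<in> words n" "w = take n w @ drop n w" by simp_all
      then show "w \<in> {c @ z | c z. c \<in> words n}" by blast
    qed
  qed auto
  then have 1: "fin_gen_ri ?R" unfolding fin_gen_ri_def by (intro exI[of _ "words n"] conjI finite_words)
  have ri: "right_ideal ?R" by (auto simp: right_ideal_def)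
  have 2: "essential_ri ?R"
  proof (rule essential_riI[OF ri])
    show "\<exists>z. x @ z \<in> ?R" for x by (intro exI[of _ "replicate n undefined"]) simp
  qed
  have b: "bij_betw (\<lambda>r. the (lift n p r)) ?R ?R"
    by (rule bij_betw_byWitness[of _ "\<lambda>r. inv' p (take n r) @ drop n r"])
      (auto simp: lift_def len permutes_inverses[OF p])
  have "dom (lift n p) = ?R" by (auto simp: lift_def split: if_splits)
  moreover have "the (lift n p (r @ z)) = the (lift n p r) @ z" if "r \<in> ?R" for r z
    using that by (simp add: lift_def)
  ultimately have "ri_iso (lift n p) ?R ?R"
    using ri b by (simp add: ri_iso_def)
  then show ?thesis using 1 2 unfolding fin_gen_ess_iso_def by blast
qed

lemma fin_gen_ess_iso_imp_ess_iso: "fin_gen_ess_iso \<phi> \<Longrightarrow> ess_iso \<phi>"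
  unfolding fin_gen_ess_iso_def ess_iso_def by blast

lemmas ess_iso_lift = fin_gen_ess_iso_imp_ess_iso[OF fin_gen_ess_iso_lift]

lemma lift_comp:
  assumes "q permutes words n"
  shows "lift n p \<circ>\<^sub>m lift n q = lift n (p \<circ> q)"
  using length_permutes_words[OF assms] by (auto simp: fun_eq_iff lift_def map_comp_def)

lemma lift_id_le: "lift n id \<subseteq>\<^sub>m Some"
  by (auto simp: map_le_def lift_def split: if_splits)

lemma elem_id: "elem n id = Some"
  using max_ext_eq_if_map_le[OF ess_iso_lift[OF permutes_id] ess_iso_Some lift_id_le] max_ext_Some
  by metis

lemma elem_carrier: "p permutes words n \<Longrightarrow> elem n p \<in> carrier thompson_higman"
  using fin_gen_ess_iso_lift by (auto simp: thompson_higman_def)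

text \<open>The lift of the composite is the composite of the lifts, hence a restriction of the
  composite of the maximal extensions.\<close>

lemma elem_mult:
  assumes p: "p permutes words n" and q: "q permutes words n"
  shows "elem n p \<otimes>\<^bsub>thompson_higman\<^esub> elem n q = elem n (p \<circ> q)"
proof -
  note P = ess_iso_lift[OF p] and Q = ess_iso_lift[OF q]
  have "lift n (p \<circ> q) \<subseteq>\<^sub>m elem n p \<circ>\<^sub>m elem n q"
    unfolding lift_comp[OF q, symmetric] by (intro map_comp_mono max_extD P Q)
  then have "elem n (p \<circ> q) = max_ext (elem n p \<circ>\<^sub>m elem n q)"
    by (intro max_ext_eq_if_map_le ess_iso_lift permutes_compose ess_iso_comp max_extD(1) p q)
  then show ?thesis by (simp add: thompson_higman_def)
qed

text \<open>\<open>m_inv\<close> is a definite description, so besides the inverse laws it must be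
  shown that every two-sided inverse y in the carrier is \<open>elem n (inv' p)\<close>.\<close>

lemma elem_inv:
  assumes p: "p permutes words n"
  shows "inv\<^bsub>thompson_higman\<^esub> (elem n p) = elem n (inv' p)"
  unfolding m_inv_def
proof (rule the_equality)
  note ip = permutes_inv[OF p]
  have one: "\<one>\<^bsub>thompson_higman\<^esub> = (Some :: 'a list \<rightharpoonup> 'a list)" by (simp add: thompson_higman_def)
  have pi: "inv' p \<circ> p = id" "p \<circ> inv' p = id" using permutes_inv_o[OF p] by auto
  show "elem n (inv' p) \<in> carrier thompson_higman \<and>
    elem n p \<otimes>\<^bsub>thompson_higman\<^esub> elem n (inv' p) = \<one>\<^bsub>thompson_higman\<^esub> \<and>
    elem n (inv' p) \<otimes>\<^bsub>thompson_higman\<^esub> elem n p = \<one>\<^bsub>thompson_higman\<^esub>"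
    unfolding elem_mult[OF p ip] elem_mult[OF ip p] pi elem_id one
    using elem_carrier[OF ip] by blast
  fix y :: "'a list \<rightharpoonup> 'a list"
  assume y: "y \<in> carrier thompson_higman \<and> elem n p \<otimes>\<^bsub>thompson_higman\<^esub> y = \<one>\<^bsub>thompson_higman\<^esub> \<and>
    y \<otimes>\<^bsub>thompson_higman\<^esub> elem n p = \<one>\<^bsub>thompson_higman\<^esub>"
  then have "y \<in> carrier thompson_higman" and yP: "y \<otimes>\<^bsub>thompson_higman\<^esub> elem n p = \<one>\<^bsub>thompson_higman\<^esub>"
    by blast+
  then obtain \<phi> where \<phi>: "fin_gen_ess_iso \<phi>" "y = max_ext \<phi>"
    unfolding thompson_higman_def by auto
  note e\<phi> = fin_gen_ess_iso_imp_ess_iso[OF \<phi>(1)]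
  have ey: "ess_iso y" and my: "max_ext y = y"
    unfolding \<phi>(2) by (rule max_extD(1)[OF e\<phi>], rule max_ext_max_ext[OF e\<phi>])
  have eP: "ess_iso (elem n p)" and eI: "ess_iso (elem n (inv' p))"
    by (rule max_extD(1)[OF ess_iso_lift[OF p]], rule max_extD(1)[OF ess_iso_lift[OF ip]])
  have "max_ext (y \<circ>\<^sub>m elem n p) = Some" using yP by (simp add: thompson_higman_def)
  then have yp: "y \<circ>\<^sub>m elem n p \<subseteq>\<^sub>m Some" using max_extD(2)[OF ess_iso_comp[OF ey eP]] by simp
  \<comment> \<open>A common restriction of y and \<open>elem n (inv' p)\<close>: the inner
    composite is the identity on words of length at least n, while regrouping lets y cancel against
    p.\<close>
  let ?c = "y \<circ>\<^sub>m (lift n p \<circ>\<^sub>m lift n (inv' p))"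
  have ec: "ess_iso ?c" by (intro ess_iso_comp ey ess_iso_lift p ip)
  have "?c \<subseteq>\<^sub>m y \<circ>\<^sub>m Some"
    unfolding lift_comp[OF ip] pi by (intro map_comp_mono lift_id_le) simp
  then have cy: "?c \<subseteq>\<^sub>m y" by (simp add: map_comp_def)
  have "?c \<subseteq>\<^sub>m y \<circ>\<^sub>m (elem n p \<circ>\<^sub>m elem n (inv' p))"
    by (intro map_comp_mono max_extD(2) ess_iso_lift p ip) simp
  also have "y \<circ>\<^sub>m (elem n p \<circ>\<^sub>m elem n (inv' p)) = (y \<circ>\<^sub>m elem n p) \<circ>\<^sub>m elem n (inv' p)"
    by (auto simp: map_comp_def fun_eq_iff split: option.splits)
  finally have "?c \<subseteq>\<^sub>m (y \<circ>\<^sub>m elem n p) \<circ>\<^sub>m elem n (inv' p)" .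
  moreover have "(y \<circ>\<^sub>m elem n p) \<circ>\<^sub>m elem n (inv' p) \<subseteq>\<^sub>m Some \<circ>\<^sub>m elem n (inv' p)"
    by (intro map_comp_mono yp) simp
  moreover have "Some \<circ>\<^sub>m elem n (inv' p) = elem n (inv' p)"
    by (auto simp: map_comp_def fun_eq_iff split: option.splits)
  ultimately have ci: "?c \<subseteq>\<^sub>m elem n (inv' p)" by (metis (no_types) map_le_trans)
  have "y = max_ext ?c" unfolding max_ext_eq_if_map_le[OF ec ey cy] my ..
  also have "\<dots> = max_ext (elem n (inv' p))" by (rule max_ext_eq_if_map_le[OF ec eI ci])
  also have "\<dots> = elem n (inv' p)" by (rule max_ext_max_ext[OF ess_iso_lift[OF ip]])
  finally show "y = elem n (inv' p)" .
qed

text \<open>The lift at length n + 1 is the lift at length n restricted to words of length at least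
  n + 1. In this way the symmetric groups on words of growing length embed into one another.\<close>

lemma elem_on_init:
  assumes p: "p permutes words n"
  shows "elem (Suc n) (on_init n p) = elem n p"
proof (rule max_ext_eq_if_map_le)
  show "lift (Suc n) (on_init n p) \<subseteq>\<^sub>m lift n p"
    unfolding map_le_def
  proof
    fix w assume "w \<in> dom (lift (Suc n) (on_init n p))"
    then have w: "Suc n \<le> length w" by (auto simp: lift_def split: if_splits)
    then have "take (Suc n) w = take n w @ [w ! n]" "drop n w = w ! n # drop (Suc n) w"
      by (simp_all add: take_Suc_conv_app_nth Cons_nth_drop_Suc)
    then show "lift (Suc n) (on_init n p) w = lift n p w" using w by (simp add: lift_def)
  qed
qed (auto intro: ess_iso_lift p on_init_permutes_sign)

lemma elem_lift_ge:
  assumes "p permutes words n" "n \<le> m"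
  shows "\<exists>q. q permutes words m \<and> elem m q = elem n p"
  using assms(2)
proof (induction m rule: dec_induct)
  case (step m)
  then obtain q where q: "q permutes words m" "elem m q = elem n p" by blast
  then show ?case using elem_on_init[OF q(1)] on_init_permutes_sign(1)[OF q(1)] by auto
qed (use assms in blast)

text \<open>The maximal extension may be defined on words shorter than n. Appending n letters to
  such a word reaches the domain of the lift, where lengths are preserved, and the padding
  cancels.\<close>

lemma elem_in_lp:
  assumes p: "p permutes words n"
  shows "elem n p \<in> lp_thompson_higman"
proof -
  have "length y = length x" if xy: "elem n p x = Some y" for x y
  proof -
    note P = ess_iso_lift[OF p]
    let ?z = "replicate n undefined"
    have "elem n p (x @ ?z) = Some (y @ ?z)" using ess_isoD(3)[OF max_extD(1)[OF P] xy] .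
    moreover have "elem n p (x @ ?z) = lift n p (x @ ?z)"
      using max_extD(2)[OF P] by (auto simp: map_le_def lift_def dom_def)
    ultimately have "y @ ?z = p (take n (x @ ?z)) @ drop n (x @ ?z)" by (simp add: lift_def)
    then have "length (y @ ?z) = length (x @ ?z)"
      using length_permutes_words[OF p] by (metis append_take_drop_id length_append)
    then show ?thesis by simp
  qed
  then have "length (the (elem n p x)) = length x" if "x \<in> dom (elem n p)" for x
    using that by auto
  then show ?thesis using elem_carrier[OF p] by (simp add: lp_thompson_higman_def)
qed

text \<open>Take n to bound the lengths of finitely many generators of the domain. A word of length
  n extends into the domain, so some generator is a prefix of an extension and, being no longer than
  n, of the word itself. Hence \<phi> is defined on all of \<open>words n\<close> and permutes
  them.\<close>

lemma lp_thompson_higman_elem: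
  assumes "\<phi> \<in> (lp_thompson_higman :: ('a::finite list \<rightharpoonup> 'a list) set)"
  shows "\<exists>n p. p permutes words n \<and> \<phi> = elem n p"
proof -
  have len: "length y = length x" if "\<phi> x = Some y" for x y
  proof -
    have "\<forall>x\<in>dom \<phi>. length (the (\<phi> x)) = length x"
      using assms unfolding lp_thompson_higman_def by blast
    then show ?thesis using that by force
  qed
  obtain \<psi> where \<psi>: "fin_gen_ess_iso \<psi>" "\<phi> = max_ext \<psi>"
  proof -
    have "\<phi> \<in> carrier thompson_higman" using assms unfolding lp_thompson_higman_def by blast
    then show ?thesis using that unfolding thompson_higman_def by auto
  qed
  have e: "ess_iso \<psi>" using fin_gen_ess_iso_imp_ess_iso \<psi>(1) .
  have e\<phi>: "ess_iso \<phi>" "\<psi> \<subseteq>\<^sub>m \<phi>" using max_extD[OF e] \<psi>(2) by auto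
  obtain C where C: "finite C" "dom \<psi> = {c @ z | c z. c \<in> C}"
  proof -
    have "fin_gen_ri (dom \<psi>)" using \<psi>(1) unfolding fin_gen_ess_iso_def ri_iso_def by auto
    then show ?thesis using that unfolding fin_gen_ri_def by blast
  qed
  define n where "n = Max (length ` C)"
  have n: "length c \<le> n" if "c \<in> C" for c using that C(1) by (simp add: n_def)
  have def: "\<exists>y. \<phi> x = Some y \<and> length y = n" if x: "length x = n" for x
  proof -
    obtain z where "x @ z \<in> dom \<psi>" using essential_ri_extend[OF ess_isoD(1)[OF e]] .
    then obtain c u where c: "c \<in> C" "x @ z = c @ u" using C(2) by blast
    have "take (length c) (x @ z) = c" by (simp add: c(2))
    then have "take (length c) x = c" using n[OF c(1)] x by simp
    then have "x = c @ drop (length c) x" by (metis append_take_drop_id)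
    then have "x \<in> dom \<psi>" using C(2) c(1) by blast
    then have "x \<in> dom \<phi>" using map_le_implies_dom_le[OF e\<phi>(2)] by blast
    then show ?thesis using len x by blast
  qed
  define p where "p w = (if length w = n then the (\<phi> w) else w)" for w
  have p\<phi>: "\<phi> w = Some (p w)" "length (p w) = n" if "length w = n" for w
    using def[OF that] that by (auto simp: p_def)
  have "inj_on p (words n)"
  proof (rule inj_onI)
    fix x y assume "x \<in> words n" "y \<in> words n" "p x = p y"
    then have "\<phi> x = Some (p x)" "\<phi> y = Some (p x)" using p\<phi>(1) by simp_all
    then show "x = y" by (rule ess_isoD(4)[OF e\<phi>(1)])
  qed
  moreover have "p ` words n \<subseteq> words n" using p\<phi> by auto
  ultimately have "bij_betw p (words n) (words n)"
    using endo_inj_surj[OF finite_words] unfolding bij_betw_def by blast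
  then have p: "p permutes words n" by (rule bij_imp_permutes) (simp add: p_def)
  have "lift n p \<subseteq>\<^sub>m \<phi>"
    unfolding map_le_def
  proof
    fix w assume "w \<in> dom (lift n p)"
    then have w: "n \<le> length w" by (auto simp: lift_def split: if_splits)
    then have "\<phi> (take n w) = Some (p (take n w))" using p\<phi> by simp
    from ess_isoD(3)[OF e\<phi>(1) this, of "drop n w"] show "lift n p w = \<phi> w"
      using w by (simp add: lift_def)
  qed
  then have "elem n p = max_ext \<phi>" by (rule max_ext_eq_if_map_le[OF ess_iso_lift[OF p] e\<phi>(1)])
  then have "elem n p = \<phi>" using \<psi>(2) max_ext_max_ext[OF e] by simp
  then show ?thesis using p by blast
qed

section \<open>Gates and their action on words of a given length\<close>

text \<open>An involution of the first m letters that ignores all later ones. The named generators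
  are all involutions, and \<open>f u' = Some u\<close> gives bijectivity at once.\<close>

definition gate :: "nat \<Rightarrow> ('a::finite list \<rightharpoonup> 'a list) \<Rightarrow> bool" where
  "gate m f \<longleftrightarrow> (\<forall>w. length w < m \<longrightarrow> f w = None) \<and>
    (\<forall>u. length u = m \<longrightarrow> (\<exists>u'. length u' = m \<and> f u' = Some u \<and> (\<forall>v. f (u @ v) = Some (u' @ v))))"

lemma gate_lift:
  assumes "gate m f"
  shows "action m f permutes words m" "f = lift m (action m f)"
proof -
  have g: "\<exists>u'. length u' = m \<and> f u' = Some u \<and> (\<forall>v. f (u @ v) = Some (u' @ v))" if "length u = m" for u
    using assms that unfolding gate_def by blast
  have a: "length (action m f u) = m \<and> action m f (action m f u) = u
    \<and> f (u @ v) = Some (action m f u @ v)" if u: "length u = m" for u v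
  proof -
    obtain u' where u': "length u' = m" "f u' = Some u" "\<And>v. f (u @ v) = Some (u' @ v)"
      using g[OF u] by blast
    then have "action m f u = u'" using u'(3)[of "[]"] u by (simp add: action_def)
    then show ?thesis using u' by (simp add: action_def)
  qed
  show "action m f permutes words m"
    using a by (intro bij_imp_permutes bij_betw_byWitness[of _ "action m f"]) auto
  show "f = lift m (action m f)"
  proof
    fix w
    show "f w = lift m (action m f) w"
      using assms a[of "take m w" "drop m w"] by (cases "m \<le> length w") (auto simp: lift_def gate_def)
  qed
qed

lemma action_Suc:
  assumes "gate m f" "m \<le> n"
  shows "action (Suc n) f = on_init n (action n f)"
proof
  fix w
  obtain q where f: "f = lift m q" using gate_lift(2)[OF assms(1)] by blast
  show "action (Suc n) f w = on_init n (action n f) w"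
  proof (cases "length w = Suc n")
    case True
    then obtain u s where w: "w = u @ [s]" "length u = n" by (auto simp: length_Suc_conv_rev)
    then show ?thesis using assms(2) by (simp add: action_def f lift_def)
  qed simp
qed

text \<open>A gate represents the same group element whatever length n \<ge> m it is read
  at.\<close>

lemma gate_action:
  assumes "gate m f" "m \<le> n"
  shows "action n f permutes words n \<and> elem n (action n f) = max_ext f"
  using assms(2)
proof (induction n rule: dec_induct)
  case base
  then show ?case using gate_lift[OF assms(1)] by metis
next
  case (step k)
  then have "action k f permutes words k" by blast
  then show ?case
    using step action_Suc[OF assms(1), of k] on_init_permutes_sign(1)[of "action k f" k]
      elem_on_init[of "action k f" k] by simp
qed

lemma gates: "gate 1 not_gate" "gate 2 cnot_gate" "gate 3 toffoli_gate"
proof -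
  have b: "x + 1 + 1 = x" "x + y + y = x" for x y :: bit by (cases x; cases y; simp)+
  show "gate 1 not_gate"
    unfolding gate_def
  proof (intro conjI allI impI)
    show "not_gate w = None" if "length w < 1" for w using that by simp
    fix u :: "bit list" assume "length u = 1"
    then obtain x where "u = [x]" by (auto simp: length_Suc_conv)
    then show "\<exists>u'. length u' = 1 \<and> not_gate u' = Some u \<and> (\<forall>v. not_gate (u @ v) = Some (u' @ v))"
      by (intro exI[of _ "[x + 1]"]) (simp only: b not_gate.simps append.simps list.size, simp)
  qed
  show "gate 2 cnot_gate"
    unfolding gate_def
  proof (intro conjI allI impI)
    show "cnot_gate w = None" if "length w < 2" for w
      using that by (cases w rule: cnot_gate.cases) auto
    fix u :: "bit list" assume "length u = 2"
    then obtain x y where "u = [x, y]" by (auto simp: length_Suc_conv numeral_2_eq_2)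
    then show "\<exists>u'. length u' = 2 \<and> cnot_gate u' = Some u \<and> (\<forall>v. cnot_gate (u @ v) = Some (u' @ v))"
      by (intro exI[of _ "[x, y + x]"]) (simp only: b cnot_gate.simps append.simps list.size, simp)
  qed
  show "gate 3 toffoli_gate"
    unfolding gate_def
  proof (intro conjI allI impI)
    show "toffoli_gate w = None" if "length w < 3" for w
      using that by (cases w rule: toffoli_gate.cases) auto
    fix u :: "bit list" assume "length u = 3"
    then obtain x y z where "u = [x, y, z]" by (auto simp: length_Suc_conv numeral_3_eq_3)
    then show "\<exists>u'. length u' = 3 \<and> toffoli_gate u' = Some u \<and> (\<forall>v. toffoli_gate (u @ v) = Some (u' @ v))"
      by (intro exI[of _ "[x, y, z + y * x]"]) (simp only: b toffoli_gate.simps append.simps list.size, simp)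
  qed
qed

lemma gate_transp:
  assumes "1 \<le> i"
  shows "gate (i + 1) (transp i (i + 1))"
proof -
  obtain j where j: "i = Suc j" using assms by (cases i) auto
  have "\<exists>u'. length u' = i + 1 \<and> transp i (i + 1) u' = Some u
    \<and> (\<forall>v. transp i (i + 1) (u @ v) = Some (u' @ v))" if u: "length u = i + 1" for u :: "'a list"
  proof -
    obtain w x y where w: "u = w @ [x, y]" "length w = j"
      using u by (auto simp: j length_Suc_conv_rev)
    then show ?thesis
      using transp_adjacent[of w j y x "[]"] transp_adjacent[of w j x y]
      by (intro exI[of _ "w @ [y, x]"]) (simp add: j)
  qed
  moreover have "transp i (i + 1) w = None" if "length w < i + 1" for w :: "'a list"
    using that by (simp add: transp_def)
  ultimately show ?thesis by (simp add: gate_def)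
qed

text \<open>Needed for the transposition of the last two positions, which involves the last letter
  and so does not come from \<open>on_init\<close>.\<close>

lemma action_transp_last:
  assumes "1 \<le> i" "i < n"
  shows "action (Suc n) (transp (Suc i) (Suc (Suc i))) = on_tail n (action n (transp i (Suc i)))"
proof
  fix w :: "'a list"
  show "action (Suc n) (transp (Suc i) (Suc (Suc i))) w = on_tail n (action n (transp i (Suc i))) w"
  proof (cases "length w = Suc n")
    case True
    then obtain s u where w: "w = s # u" "length u = n" by (auto simp: length_Suc_conv)
    obtain j where "i = Suc j" using assms by (cases i) auto
    then show ?thesis using w assms(2) by (auto simp: action_def transp_def)
  qed simp
qed

section \<open>Generation\<close>

lemma evenperm_iff_sign: "evenperm p \<longleftrightarrow> sign p = 1"
  by (simp add: sign_def)

lemma evenperm_lifted: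
  fixes p :: "'a::finite list \<Rightarrow> 'a list"
  assumes p: "p permutes words n" and k: "even (card (UNIV :: 'a set))"
  shows "evenperm (on_init n p)" "evenperm (on_tail n p)"
  using k unfolding evenperm_iff_sign on_init_permutes_sign(2)[OF p] on_tail_permutes_sign(2)[OF p]
  by (auto simp: sign_def)

text \<open>To multiply two length-preserving elements, both are first represented by permutations
  of words of one common length.\<close>

lemma generate_subset_lp:
  fixes S :: "('a::finite list \<rightharpoonup> 'a list) set"
  assumes S: "S \<subseteq> lp_thompson_higman" and h: "h \<in> generate thompson_higman S"
  shows "h \<in> lp_thompson_higman"
  using h
proof induction
  case one
  have "elem 0 id \<in> (lp_thompson_higman :: ('a list \<rightharpoonup> 'a list) set)"
    by (rule elem_in_lp[OF permutes_id])
  then show ?case unfolding elem_id by (simp add: thompson_higman_def)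
next
  case (incl h)
  then show ?case using S by blast
next
  case (inv h)
  then have "h \<in> lp_thompson_higman" using S by blast
  then obtain n p where p: "p permutes words n" "h = elem n p"
    using lp_thompson_higman_elem by blast
  show ?case unfolding p(2) elem_inv[OF p(1)] by (rule elem_in_lp[OF permutes_inv[OF p(1)]])
next
  case (eng h1 h2)
  obtain n p where p: "p permutes words n" "h1 = elem n p"
    using lp_thompson_higman_elem[OF eng.IH(1)] by blast
  obtain m q where q: "q permutes words m" "h2 = elem m q"
    using lp_thompson_higman_elem[OF eng.IH(2)] by blast
  obtain p' where p': "p' permutes words (max n m)" "elem (max n m) p' = elem n p"
    using elem_lift_ge[OF p(1), of "max n m"] by auto
  obtain q' where q': "q' permutes words (max n m)" "elem (max n m) q' = elem m q"
    using elem_lift_ge[OF q(1), of "max n m"] by auto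
  show ?case
    unfolding p(2) q(2) p'(2)[symmetric] q'(2)[symmetric] elem_mult[OF p'(1) q'(1)]
    by (rule elem_in_lp[OF permutes_compose[OF q'(1) p'(1)]])
qed

section \<open>Levels of a generated subgroup and generation of the length-preserving group\<close>

definition level :: "('a::finite list \<rightharpoonup> 'a list) set \<Rightarrow> nat \<Rightarrow> ('a list \<Rightarrow> 'a list) set" where
  "level H n = {p. p permutes words n \<and> elem n p \<in> H}"

lemma perm_group_level:
  fixes S :: "('a::finite list \<rightharpoonup> 'a list) set"
  shows "perm_group (words n) (level (generate thompson_higman S) n)"
proof (rule perm_groupI[OF finite_words])
  show "id \<in> level (generate thompson_higman S) n"
    using generate.one[of thompson_higman S] permutes_id
    unfolding level_def by (simp add: elem_id) (simp add: thompson_higman_def)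
  fix p q :: "'a list \<Rightarrow> 'a list"
  assume "p \<in> level (generate thompson_higman S) n" "q \<in> level (generate thompson_higman S) n"
  then have p: "p permutes words n" "elem n p \<in> generate thompson_higman S"
    and q: "q permutes words n" "elem n q \<in> generate thompson_higman S"
    unfolding level_def by blast+
  have "elem n (p \<circ> q) \<in> generate thompson_higman S"
    unfolding elem_mult[OF p(1) q(1), symmetric] by (rule generate.eng[OF p(2) q(2)])
  then show "p \<circ> q \<in> level (generate thompson_higman S) n"
    unfolding level_def using permutes_compose[OF q(1) p(1)] by blast
qed (auto simp: level_def)

lemma on_init_level:
  assumes "p \<in> level H n"
  shows "on_init n p \<in> level H (Suc n)"
proof -
  have p: "p permutes words n" "elem n p \<in> H" using assms unfolding level_def by blast+
  show ?thesis
    unfolding level_def using on_init_permutes_sign(1)[OF p(1)] p(2) elem_on_init[OF p(1)] by simp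
qed

lemma action_gate_level:
  assumes "gate m f" "m \<le> n" "max_ext f \<in> H"
  shows "action n f \<in> level H n"
  using gate_action[OF assms(1,2)] assms(3) unfolding level_def by simp

text \<open>The levels from 4 on contain all even permutations. If the alphabet size is even, any
  permutation becomes even one level higher; if it is odd, an odd permutation at level 4 stays odd
  at all higher levels and supplies the other coset.\<close>

lemma generate_eq_lp:
  fixes S :: "('a::finite list \<rightharpoonup> 'a list) set"
  assumes k: "2 \<le> card (UNIV :: 'a set)" and S: "S \<subseteq> lp_thompson_higman"
    and sw: "\<And>i. 1 \<le> i \<Longrightarrow> max_ext (transp i (i + 1)) \<in> S"
    and base: "\<And>p. p permutes words 4 \<Longrightarrow> evenperm p
      \<Longrightarrow> p \<in> level (generate thompson_higman S) 4"
    and odd: "odd (card (UNIV :: 'a set)) \<Longrightarrow>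
      \<exists>t \<in> level (generate thompson_higman S) 4. \<not> evenperm t"
  shows "generate thompson_higman S = lp_thompson_higman"
proof
  let ?H = "generate thompson_higman S"
  show "?H \<subseteq> lp_thompson_higman" using generate_subset_lp[OF S] by blast
  have even: "p \<in> level ?H n" if "4 \<le> n" "p permutes words n" "evenperm p" for n p
  proof (rule even_words_in_perm_groups[of "level ?H", OF _ k _ _ _ that])
    fix n i :: nat assume "1 \<le> i" "i < n"
    then show "action n (transp i (i + 1)) \<in> level ?H n"
      by (intro action_gate_level[OF gate_transp] generate.incl sw) auto
  qed (use perm_group_level on_init_level base in blast)+
  have odd_elt: "\<exists>t \<in> level ?H n. \<not> evenperm t" if "4 \<le> n" "odd (card (UNIV :: 'a set))" for n
    using that(1)
  proof (induction n rule: dec_induct)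
    case base
    then show ?case using odd that(2) by blast
  next
    case (step n)
    then obtain t where t: "t \<in> level ?H n" "\<not> evenperm t" by blast
    then have tp: "t permutes words n" by (simp add: level_def)
    have "\<not> evenperm (on_init n t)"
      using t(2) that(2) on_init_permutes_sign(2)[OF tp] by (simp add: sign_def split: if_splits)
    then show ?case using on_init_level[OF t(1)] by blast
  qed
  have all: "on_init n p \<in> level ?H (Suc n)" if n: "4 \<le> n" and p: "p permutes words n" for n p
  proof (cases "even (card (UNIV :: 'a set))")
    case True
    then show ?thesis
      using even[of "Suc n"] n on_init_permutes_sign(1)[OF p] evenperm_lifted(1)[OF p] by simp
  next
    case False
    have "p \<in> level ?H n"
    proof (cases "evenperm p")
      case False
      obtain t where t: "t \<in> level ?H n" "\<not> evenperm t"
        using odd_elt[OF n] \<open>odd (card UNIV)\<close> by blast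
      note K = perm_groupD[OF perm_group_level[of n S]]
      have tp: "t permutes words n" using K(1) t(1) by blast
      \<comment> \<open>Both factors are odd, so p is an even permutation times t.\<close>
      have ev: "evenperm (p \<circ> inv' t)"
        using permutes_imp_permutation[OF finite_words p] permutes_imp_permutation[OF finite_words tp]
          False t(2) by (simp add: evenperm_comp evenperm_inv permutation_inverse)
      have "p \<circ> inv' t \<in> level ?H n"
        by (rule even[OF n permutes_compose[OF permutes_inv[OF tp] p] ev])
      then have "(p \<circ> inv' t) \<circ> t \<in> level ?H n" using K(3) t(1) by blast
      moreover have "(p \<circ> inv' t) \<circ> t = p" using permutes_inv_o(2)[OF tp] by (simp add: comp_assoc)
      ultimately show ?thesis by simp
    qed (use even n p in blast)
    then show ?thesis by (rule on_init_level)
  qed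
  show "lp_thompson_higman \<subseteq> ?H"
  proof
    fix \<phi> :: "'a list \<rightharpoonup> 'a list" assume "\<phi> \<in> lp_thompson_higman"
    then obtain n p where p: "p permutes words n" "\<phi> = elem n p"
      using lp_thompson_higman_elem by blast
    obtain q where q: "q permutes words (max 4 n)" "elem (max 4 n) q = elem n p"
      using elem_lift_ge[OF p(1), of "max 4 n"] by auto
    \<comment> \<open>The additional letter is what turns odd permutations into even ones for an
      alphabet of even size.\<close>
    have "on_init (max 4 n) q \<in> level ?H (Suc (max 4 n))" by (rule all[OF _ q(1)]) simp
    then show "\<phi> \<in> ?H" unfolding p(2) q(2)[symmetric] elem_on_init[OF q(1), symmetric] level_def by blast
  qed
qed

lemma max_ext_gate_lp:
  assumes "gate m f"
  shows "max_ext f \<in> lp_thompson_higman"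
  using gate_action[OF assms order_refl] elem_in_lp by metis

lemma card_bit: "card (UNIV :: bit set) = 2"
proof -
  have "(UNIV :: bit set) = {0, 1}" using bit_not_zero_iff by blast
  then show ?thesis by (metis card_2_iff zero_neq_one)
qed

lemma generate_lp_bit:
  "generate thompson_higman
     (max_ext ` ({not_gate, cnot_gate, toffoli_gate} \<union> {transp i (i + 1) | i. 1 \<le> i}))
   = (lp_thompson_higman :: (bit list \<rightharpoonup> bit list) set)" (is "generate _ ?S = _")
proof (rule generate_eq_lp)
  let ?H = "generate thompson_higman ?S"
  have tr: "max_ext (transp i (i + 1)) \<in> ?S" if "1 \<le> i" for i using that by blast
  show "max_ext (transp i (i + 1)) \<in> ?S" if "1 \<le> i" for i using tr that .
  show "?S \<subseteq> lp_thompson_higman" using max_ext_gate_lp gates gate_transp by blast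
  have H: "max_ext not_gate \<in> ?H" "max_ext cnot_gate \<in> ?H" "max_ext toffoli_gate \<in> ?H"
    by (rule generate.incl, blast)+
  have G: "action 4 not_gate \<in> level ?H 4" "action 4 cnot_gate \<in> level ?H 4"
    "action 4 toffoli_gate \<in> level ?H 4"
    by (rule action_gate_level[OF gates(1) _ H(1)] action_gate_level[OF gates(2) _ H(2)]
      action_gate_level[OF gates(3) _ H(3)]; simp)+
  have "action 4 (transp i (i + 1)) \<in> level ?H 4" if "1 \<le> i" "i < 4" for i
    using that by (intro action_gate_level[OF gate_transp] generate.incl tr) auto
  then show "p \<in> level ?H 4" if "p permutes words 4" "evenperm p" for p
    using even_words4_bit[OF perm_group_level G _ that] by blast
qed (simp_all add: card_bit)

text \<open>All permutations of the words of length 4 serve as \<Gamma>; this settles level 4,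
  including an odd permutation there.\<close>

lemma generate_lp_finite:
  assumes k: "2 \<le> card (UNIV :: 'a::finite set)"
  shows "\<exists>\<Gamma> :: ('a list \<rightharpoonup> 'a list) set. finite \<Gamma> \<and>
    generate thompson_higman (\<Gamma> \<union> max_ext ` {transp i (i + 1) | i. 1 \<le> i}) = lp_thompson_higman"
proof (intro exI conjI)
  let ?\<Gamma> = "elem 4 ` {p. p permutes words 4} :: ('a list \<rightharpoonup> 'a list) set"
  let ?S = "?\<Gamma> \<union> max_ext ` {transp i (i + 1) | i. 1 \<le> i}"
  show "finite ?\<Gamma>" by (intro finite_imageI finite_permutations finite_words)
  have all: "p \<in> level (generate thompson_higman ?S) 4" if p: "p permutes words 4" for p
  proof -
    have "elem 4 p \<in> ?S" by (intro UnI1 imageI CollectI p)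
    then have "elem 4 p \<in> generate thompson_higman ?S" by (rule generate.incl)
    then show ?thesis using p by (simp add: level_def)
  qed
  show "generate thompson_higman ?S = lp_thompson_higman"
  proof (rule generate_eq_lp[OF k])
    show "?S \<subseteq> lp_thompson_higman"
    proof (intro Un_least image_subsetI)
      show "elem 4 p \<in> lp_thompson_higman" if "p \<in> {p. p permutes words 4}"
        for p :: "'a list \<Rightarrow> 'a list" using that by (intro elem_in_lp) simp
      show "max_ext f \<in> lp_thompson_higman" if "f \<in> {transp i (i + 1) | i. 1 \<le> i}"
        for f :: "'a list \<rightharpoonup> 'a list" using that gate_transp by (blast intro: max_ext_gate_lp)
    qed
    show "max_ext (transp i (i + 1)) \<in> ?S" if "1 \<le> i" for i
      by (rule UnI2[OF imageI]) (use that in blast)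
    show "p \<in> level (generate thompson_higman ?S) 4" if "p permutes words 4" for p
      by (rule all[OF that])
    have "2 ^ 4 \<le> card (UNIV :: 'a set) ^ 4" using k by (rule power_mono) simp
    then have "\<not> card (words 4 :: 'a list set) \<le> Suc 0" by (simp add: card_words)
    then obtain a b :: "'a list" where ab: "a \<in> words 4" "b \<in> words 4" "a \<noteq> b"
      using card_le_Suc0_iff_eq[OF finite_words] by blast
    then show "\<exists>t \<in> level (generate thompson_higman ?S) 4. \<not> evenperm t"
      using all[OF permutes_swap_id[OF ab(1,2)]] evenperm_swap[of a b] by blast
  qed
qed

section \<open>Generation of the alternating groups on words of bits\<close>

lemma m_inv_alt_group_words:
  assumes "p \<in> carrier (alt_group_words n)"
  shows "inv\<^bsub>alt_group_words n\<^esub> p = inv' p" "inv' p \<in> carrier (alt_group_words n)"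
proof -
  have p: "p permutes words n" "evenperm p" using assms by (auto simp: alt_group_words_def)
  show c: "inv' p \<in> carrier (alt_group_words n)"
    using permutes_inv[OF p(1)] evenperm_inv[OF permutes_imp_permutation[OF finite_words p(1)]] p(2)
    by (simp add: alt_group_words_def)
  show "inv\<^bsub>alt_group_words n\<^esub> p = inv' p"
    unfolding m_inv_def
  proof (rule the_equality)
    show "inv' p \<in> carrier (alt_group_words n) \<and>
      p \<otimes>\<^bsub>alt_group_words n\<^esub> inv' p = \<one>\<^bsub>alt_group_words n\<^esub> \<and>
      inv' p \<otimes>\<^bsub>alt_group_words n\<^esub> p = \<one>\<^bsub>alt_group_words n\<^esub>"
      using c permutes_inv_o[OF p(1)] by (simp add: alt_group_words_def)
    show "y = inv' p" if "y \<in> carrier (alt_group_words n) \<and>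
      p \<otimes>\<^bsub>alt_group_words n\<^esub> y = \<one>\<^bsub>alt_group_words n\<^esub> \<and>
      y \<otimes>\<^bsub>alt_group_words n\<^esub> p = \<one>\<^bsub>alt_group_words n\<^esub>" for y
    proof -
      have "p \<circ> y = id" "y \<circ> p = id" using that by (simp_all add: alt_group_words_def)
      then show ?thesis by (rule inv_unique_comp[symmetric])
    qed
  qed
qed

lemma generate_alt_group_words_subset:
  assumes S: "S \<subseteq> carrier (alt_group_words n)"
  shows "generate (alt_group_words n) S \<subseteq> carrier (alt_group_words n)"
proof
  fix p assume "p \<in> generate (alt_group_words n) S"
  then show "p \<in> carrier (alt_group_words n)"
  proof induction
    case one
    then show ?case
      using permutes_id evenperm_id by (simp add: alt_group_words_def id_def)
  next
    case (incl h)
    then show ?case using S by blast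
  next
    case (inv h)
    then have h: "h \<in> carrier (alt_group_words n)" using S by blast
    show ?case unfolding m_inv_alt_group_words(1)[OF h] by (rule m_inv_alt_group_words(2)[OF h])
  next
    case (eng p q)
    then have p: "p permutes words n" "evenperm p" and q: "q permutes words n" "evenperm q"
      by (auto simp: alt_group_words_def)
    have "evenperm (p \<circ> q)"
      using evenperm_comp[OF permutes_imp_permutation[OF finite_words p(1)]
        permutes_imp_permutation[OF finite_words q(1)]] p(2) q(2) by simp
    then show ?case using permutes_compose[OF q(1) p(1)] by (simp add: alt_group_words_def o_def)
  qed
qed

definition gate_set :: "nat \<Rightarrow> (bit list \<rightharpoonup> bit list) set" where
  "gate_set n = {not_gate, cnot_gate, toffoli_gate} \<union> {transp i (i + 1) | i. 1 \<le> i \<and> i < n}"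

lemma gate_set_gate:
  assumes "4 \<le> n" "f \<in> gate_set n"
  shows "\<exists>m\<le>n. gate m f"
proof -
  consider "f = not_gate" | "f = cnot_gate" | "f = toffoli_gate"
    | i where "f = transp i (i + 1)" "1 \<le> i" "i < n"
    using assms(2) unfolding gate_set_def by blast
  then show ?thesis
  proof cases
    case 1 then show ?thesis using gates(1) assms(1) by (intro exI[of _ 1]) simp
  next
    case 2 then show ?thesis using gates(2) assms(1) by (intro exI[of _ 2]) simp
  next
    case 3 then show ?thesis using gates(3) assms(1) by (intro exI[of _ 3]) simp
  next
    case 4 then show ?thesis using gate_transp[of i] by (intro exI[of _ "i + 1"]) simp
  qed
qed

text \<open>Each generator leaves the first or the last letter alone, so it is a permutation at
  length n - 1 copied onto two blocks, hence even. For the Toffoli gate this takes n \<ge> 4: on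
  three bits it is a single transposition.\<close>

lemma action_gate_set:
  assumes n: "4 \<le> n" and f: "f \<in> gate_set n"
  shows "action n f \<in> carrier (alt_group_words n)"
proof -
  obtain m where m: "m \<le> n" "gate m f" using gate_set_gate[OF n f] by blast
  obtain l where l: "n = Suc l" "3 \<le> l" using n by (cases n) auto
  have ini: "evenperm (action n f)" if "gate j f" "j \<le> l" for j
    unfolding l(1) action_Suc[OF that]
    using evenperm_lifted(1)[OF conjunct1[OF gate_action[OF that]]] by (simp add: card_bit)
  consider "f = not_gate" | "f = cnot_gate" | "f = toffoli_gate"
    | i where "f = transp i (i + 1)" "1 \<le> i" "i < l" | "f = transp l (l + 1)"
    using f unfolding gate_set_def l(1) less_Suc_eq by blast
  then have "evenperm (action n f)"
  proof cases
    case 1 then show ?thesis using ini[of 1] gates(1) l(2) by simp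
  next
    case 2 then show ?thesis using ini[of 2] gates(2) l(2) by simp
  next
    case 3 then show ?thesis using ini[of 3] gates(3) l(2) by simp
  next
    case 4 then show ?thesis using ini[of "i + 1"] gate_transp[of i] by simp
  next
    case 5
    obtain i where i: "l = Suc i" "1 \<le> i" using l(2) by (cases l) auto
    have "action n f = on_tail l (action l (transp i (Suc i)))"
      unfolding 5 l(1) using action_transp_last[of i l] i by simp
    moreover have "action l (transp i (Suc i) :: bit list \<rightharpoonup> bit list) permutes words l"
    proof -
      have "gate (i + 1) (transp i (i + 1) :: bit list \<rightharpoonup> bit list)" by (rule gate_transp[OF i(2)])
      from gate_action[OF this, of l] show ?thesis using i by simp
    qed
    ultimately show ?thesis
      using evenperm_lifted(2)[of "action l (transp i (Suc i) :: bit list \<rightharpoonup> bit list)" l]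
      by (simp add: card_bit)
  qed
  then show ?thesis using gate_action[OF m(2,1)] by (simp add: alt_group_words_def)
qed

lemma on_init_comp:
  assumes "q permutes words n"
  shows "on_init n (p \<circ> q) = on_init n p \<circ> on_init n q"
  using length_permutes_words[OF assms] by (auto simp: on_init_def fun_eq_iff)

lemma on_init_id: "on_init n id = id"
  by (auto simp: on_init_def fun_eq_iff) (metis append_butlast_last_id list.size(3) nat.distinct(1))

text \<open>The subgroups generated at the various lengths form a family to which the induction on
  word length applies, with four bits as its base.\<close>

lemma generate_alt_group_words:
  assumes n: "4 \<le> n"
  shows "generate (alt_group_words n) (action n ` gate_set n) = carrier (alt_group_words n)"
proof
  define K where "K n = generate (alt_group_words n) (action n ` gate_set n)" for n
  have sub: "K n \<subseteq> carrier (alt_group_words n)" if "4 \<le> n" for n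
    unfolding K_def using action_gate_set[OF that]
    by (intro generate_alt_group_words_subset image_subsetI)
  then show "generate (alt_group_words n) (action n ` gate_set n) \<subseteq> carrier (alt_group_words n)"
    using n unfolding K_def by blast
  have perm: "p permutes words n" if "4 \<le> n" "p \<in> K n" for n p
    using sub[OF that(1)] that(2) by (auto simp: alt_group_words_def)
  have incl: "action n f \<in> K n" if "f \<in> gate_set n" for n f
    unfolding K_def using that by (intro generate.incl imageI)
  have id: "id \<in> K n" for n
    using generate.one[of "alt_group_words n"] by (simp add: K_def alt_group_words_def)
  have comp: "p \<circ> q \<in> K n" if "p \<in> K n" "q \<in> K n" for p q n
    using generate.eng[of p "alt_group_words n" _ q] that by (simp add: K_def alt_group_words_def)
  have grp: "perm_group (words n) (K n)" if "4 \<le> n" for n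
    using perm[OF that] id comp by (intro perm_groupI finite_words)
  \<comment> \<open>\<open>on_init\<close> is a homomorphism that takes the action of a generator at
    length n to the action of the same generator at length n + 1.\<close>
  have up: "on_init n p \<in> K (Suc n)" if n: "4 \<le> n" and p: "p \<in> K n" for n p
  proof -
    have gen: "on_init n (action n f) \<in> K (Suc n)" if f: "f \<in> gate_set n" for f
    proof -
      obtain m where m: "m \<le> n" "gate m f" using gate_set_gate[OF n f] by blast
      have "f \<in> gate_set (Suc n)" using f unfolding gate_set_def by auto
      then show ?thesis unfolding action_Suc[OF m(2,1), symmetric] by (rule incl)
    qed
    show ?thesis
      using p unfolding K_def[of n]
    proof induction
      case one
      have "\<one>\<^bsub>alt_group_words n\<^esub> = id" by (simp add: alt_group_words_def)
      then show ?case using id[of "Suc n"] on_init_id[of n] by metis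
    next
      case (incl h)
      then show ?case using gen by blast
    next
      case (inv h)
      then obtain f where f: "f \<in> gate_set n" "h = action n f" by blast
      have hc: "h \<in> carrier (alt_group_words n)" unfolding f(2) by (rule action_gate_set[OF n f(1)])
      then have h: "h permutes words n" by (simp add: alt_group_words_def)
      have "on_init n (inv' h) \<circ> on_init n h = id" "on_init n h \<circ> on_init n (inv' h) = id"
        unfolding on_init_comp[OF h, symmetric] on_init_comp[OF permutes_inv[OF h], symmetric]
          permutes_inv_o[OF h] by (rule on_init_id)+
      then have "on_init n (inv' h) = inv' (on_init n h)"
        by (intro inv_unique_comp[symmetric])
      moreover have "inv' (on_init n h) \<in> K (Suc n)"
        using perm_groupD(4)[OF grp[of "Suc n"]] gen[OF f(1)] n f(2) by simp
      ultimately show ?case unfolding m_inv_alt_group_words(1)[OF hc] by simp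
    next
      case (eng p q)
      then have "q permutes words n" using perm[OF n] by (simp add: K_def)
      then have "on_init n (p \<circ> q) = on_init n p \<circ> on_init n q" by (rule on_init_comp)
      moreover have "p \<otimes>\<^bsub>alt_group_words n\<^esub> q = p \<circ> q" by (simp add: alt_group_words_def)
      ultimately show ?case using comp[OF eng.IH] by metis
    qed
  qed
  have sw: "action n (transp i (i + 1)) \<in> K n" if "1 \<le> i" "i < n" for n i
    by (rule incl) (use that in \<open>auto simp: gate_set_def\<close>)
  have g4: "action 4 not_gate \<in> K 4" "action 4 cnot_gate \<in> K 4" "action 4 toffoli_gate \<in> K 4"
    by (rule incl, simp add: gate_set_def)+
  show "carrier (alt_group_words n) \<subseteq> generate (alt_group_words n) (action n ` gate_set n)"
  proof
    fix p assume "p \<in> carrier (alt_group_words n)"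
    then have p: "p permutes words n" "evenperm p" by (simp_all add: alt_group_words_def)
    have "p \<in> K n"
    proof (rule even_words_in_perm_groups[of K, OF grp _ _ up _ n p])
      show "q \<in> K 4" if "q permutes words 4" "evenperm q" for q
        using even_words4_bit[OF grp[of 4] g4 sw that] by simp
    qed (use sw in \<open>simp_all add: card_bit\<close>)
    then show "p \<in> generate (alt_group_words n) (action n ` gate_set n)" by (simp add: K_def)
  qed
qed

theorem proposition5p1:
  shows "generate thompson_higman
           (max_ext ` ({not_gate, cnot_gate, toffoli_gate} \<union> {transp i (i + 1) | i. 1 \<le> i}))
         = (lp_thompson_higman :: (bit list \<rightharpoonup> bit list) set)
    \<and> (card (UNIV :: 'a::finite set) \<ge> 2 \<longrightarrow>
         (\<exists>\<Gamma> :: ('a list \<rightharpoonup> 'a list) set. finite \<Gamma> \<and>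
            generate thompson_higman (\<Gamma> \<union> max_ext ` {transp i (i + 1) | i. 1 \<le> i})
            = lp_thompson_higman))
    \<and> (\<forall>n\<ge>4.
         generate (alt_group_words n)
           (action n ` ({not_gate, cnot_gate, toffoli_gate}
                        \<union> {transp i (i + 1) | i. 1 \<le> i \<and> i < n}))
         = carrier (alt_group_words n))"
  using generate_lp_bit generate_lp_finite generate_alt_group_words[unfolded gate_set_def] by blast

end
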